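(* Let $\omega,\gamma,\lambda$ be strictly positive sequences with $\gamma_1=\omega_1=\lambda_1=1$ such that $(\omega_j/\gamma_j)_{j\ge1}$ and $(\lambda_j)_{j\ge1}$ are non-increasing. With $M_\sigma^+:=M_\sigma^{\sqrt{4d\lambda}}$, suppose there is a constant $L>0$ depending only on $\lambda$ and $d$ such that $$\sigma^{-7}\,\lambda_{M_\sigma^++1}^{-1/2}\exp\Big(-\frac{\lambda_{M_\sigma^++1}}{72\,\sigma d}\Big)\le L\qquad\text{for all }\sigma\in(0,1).$$ Let $K^-_{\varepsilon,\sigma}:=K_{\varepsilon,\sigma}^{\sqrt{\lambda/(4d)}}$ and $\upsilon_\sigma:=\max_{k\in\mathbb N}\big\{\frac{\omega_k}{\gamma_k}\min(1,\frac{\sigma}{\lambda_k})\big\}$. Then there is a constant $C>0$ depending only on the class $\mathcal T_\lambda^d$ such that for all $\varepsilon,\sigma\in(0,1)$ the adaptive estimator $\hat f_{\hat k}$ satisfies $$\sup_{f\in\mathcal F_\gamma^r}\ \sup_{T\in\mathcal T_\lambda^d}\mathbb E\|\hat f_{\hat k}-f\|_\omega^2\ \le\ C\,(1+r)\Big\{\min_{1\le k\le K^-_{\varepsilon,\sigma}}\max\Big(\frac{\omega_k}{\gamma_k},\ \delta_k^{\sqrt\lambda}\,\varepsilon\Big)+\upsilon_\sigma+\varepsilon+\sigma\Big\}.$$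
   Context: Let $H,G$ be real infinite-dimensional separable Hilbert spaces, $(\varphi_j)_{j\ge1}$ a fixed orthonormal basis of $H$ and $(\psi_j)_{j\ge1}$ a fixed orthonormal system in $G$. For $h\in H$ put $[h]_j:=\langle h,\varphi_j\rangle_H$. Let $C(H,G)$ be the set of compact linear operators $T:H\to G$ with $T\varphi_j=a_j\psi_j$ and $a_j>0$ for all $j$; $(a_j)$ are the singular values of $T$. Model: for noise levels $\varepsilon,\sigma\in(0,1)$, unknown $f\in H$ and unknown $T\in C(H,G)$ with singular values $(a_j)$, one observes $$Y_j=a_j[f]_j+\sqrt\varepsilon\,\xi_j,\qquad X_j=a_j+\sqrt\sigma\,\zeta_j\qquad(j\ge1),$$ where all $\xi_j,\zeta_j$ are i.i.d. standard normal. Put $X=(X_j)_{j\ge1}$ and $$\hat f_k:=\sum_{j=1}^k\frac{Y_j}{X_j}\mathbf 1\{X_j^2\ge\sigma\}\,\varphi_j .$$ For a positive sequence $w$, $\|h\|_w^2:=\sum_{j\ge1}w_j|[h]_j|^2$. For $r>0$, $d\ge1$: $$\mathcal F_\gamma^r:=\{h\in H:\|h\|_\gamma^2\le r\},\qquad \mathcal T_\lambda^d:=\{T\in C(H,G): 1/d\le a_j^2/\lambda_j\le d\ \ \forall j\ge1\},$$ and $\lambda_j\to0$ (equivalently $\mathcal T_\lambda^d\ne\emptyset$). Auxiliary quantities: for a sequence $\alpha=(\alpha_j)_{j\ge1}$ of nonzero reals, $$\Delta_k^\alpha:=\max_{1\le j\le k}\omega_j\alpha_j^{-2},\qquad \delta_k^\alpha:=k\,\Delta_k^\alpha\,\frac{\log(\Delta_k^\alpha\vee(k+2))}{\log(k+2)}.$$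 With $\omega_k^+:=\max_{1\le j\le k}\omega_j$, $N_\varepsilon^\circ:=\max\{1\le N\le\varepsilon^{-1}:\omega_N^+\le\varepsilon^{-1}\}$ and $v_\sigma:=(8\log\log(\sigma^{-1}+20))^{-1}$, put $$N_\varepsilon^\alpha:=\min\Big\{2\le j\le N_\varepsilon^\circ:\frac{\alpha_j^2}{j\,\omega_j^+}\le\varepsilon|\log\varepsilon|\Big\}-1,\qquad M_\sigma^\alpha:=\min\{2\le j\le\sigma^{-1}:\alpha_j^2\le\sigma^{1-v_\sigma}\}-1,$$ with $N_\varepsilon^\alpha:=N_\varepsilon^\circ$, resp. $M_\sigma^\alpha:=\lfloor\sigma^{-1}\rfloor$, if the defining set is empty, and $K_{\varepsilon,\sigma}^\alpha:=N_\varepsilon^\alpha\wedge M_\sigma^\alpha$. Sequences such as $\sqrt{4d\lambda}=(\sqrt{4d\lambda_j})_j$, $\sqrt{\lambda/(4d)}$, $\sqrt\lambda$ are meant termwise. Adaptive choice: $\hat K:=K_{\varepsilon,\sigma}^X$ and $\widehat{\mathrm{pen}}_k:=600\,\delta_k^X\,\varepsilon$ (that is, $K_{\varepsilon,\sigma}^\alpha$ and $\delta_k^\alpha$ evaluated at the random sequence $\alpha=X=(X_j)_{j\ge1}$), $$\widehat{\mathrm{con}}_k:=\max_{k\le j\le\hat K}\big\{\|\hat f_j-\hat f_k\|_\omega^2-\widehat{\mathrm{pen}}_j\big\},\qquad \hat k:=\operatorname{argmin}_{1\le k\le\hat K}\big\{\widehat{\mathrm{con}}_k+\widehat{\mathrm{pen}}_k\big\},$$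 the argmin being the smallest minimizer. *)

theory Defs
  imports "HOL-Probability.Probability"
begin

text \<open>
  All sequences are indexed by the positive integers. They are functions on \<^typ>\<open>nat\<close> whose
  value at 0 is never used. Separable Hilbert spaces are types of class \<^class>\<open>real_inner\<close> and
  \<^class>\<open>polish_space\<close> (complete, second countable); infinite dimension follows from the
  orthonormal sequences living in them.
\<close>

section \<open>Spaces, operators and ellipsoids\<close>

definition orthonormal_seq :: "(nat \<Rightarrow> 'a::real_inner) \<Rightarrow> bool" where
  "orthonormal_seq e \<longleftrightarrow> (\<forall>i\<ge>1. \<forall>j\<ge>1. e i \<bullet> e j = (if i = j then 1 else 0))"

definition orthonormal_basis :: "(nat \<Rightarrow> 'a::real_inner) \<Rightarrow> bool" where
  "orthonormal_basis e \<longleftrightarrow> orthonormal_seq e \<and> closure (span (e ` {1..})) = UNIV"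

definition compact_operator :: "('a::real_normed_vector \<Rightarrow> 'b::real_normed_vector) \<Rightarrow> bool" where
  "compact_operator T \<longleftrightarrow> linear T \<and> (\<forall>S. bounded S \<longrightarrow> compact (closure (T ` S)))"

definition diag_operators ::
  "(nat \<Rightarrow> 'h::real_inner) \<Rightarrow> (nat \<Rightarrow> 'g::real_inner) \<Rightarrow> ('h \<Rightarrow> 'g) set" where
  "diag_operators \<phi> \<psi> =
     {T. compact_operator T \<and> (\<exists>a. \<forall>j\<ge>1. a j > 0 \<and> T (\<phi> j) = a j *\<^sub>R \<psi> j)}"

text \<open>Well defined on \<^const>\<open>diag_operators\<close> at indices \<open>j \<ge> 1\<close>, since \<open>\<psi> j\<close> is then a unit vector.\<close>
definition sing_val ::
  "(nat \<Rightarrow> 'h::real_inner) \<Rightarrow> (nat \<Rightarrow> 'g::real_inner) \<Rightarrow> ('h \<Rightarrow> 'g) \<Rightarrow> nat \<Rightarrow> real" where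
  "sing_val \<phi> \<psi> T j = (THE a. T (\<phi> j) = a *\<^sub>R \<psi> j)"

definition coeff_of :: "(nat \<Rightarrow> 'h::real_inner) \<Rightarrow> 'h \<Rightarrow> nat \<Rightarrow> real" where
  "coeff_of \<phi> h j = h \<bullet> \<phi> j"

text \<open>Squared weighted norm; it may be infinite. The index is shifted so that the sum starts at 1.\<close>
definition wnorm_sq :: "(nat \<Rightarrow> 'h::real_inner) \<Rightarrow> (nat \<Rightarrow> real) \<Rightarrow> 'h \<Rightarrow> ennreal" where
  "wnorm_sq \<phi> w h = (\<Sum>j. ennreal (w (Suc j) * (coeff_of \<phi> h (Suc j))\<^sup>2))"

definition ellipsoid :: "(nat \<Rightarrow> 'h::real_inner) \<Rightarrow> (nat \<Rightarrow> real) \<Rightarrow> real \<Rightarrow> 'h set" where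
  "ellipsoid \<phi> \<gamma> r = {h. wnorm_sq \<phi> \<gamma> h \<le> ennreal r}"

definition operator_class ::
  "(nat \<Rightarrow> 'h::real_inner) \<Rightarrow> (nat \<Rightarrow> 'g::real_inner) \<Rightarrow> (nat \<Rightarrow> real) \<Rightarrow> real \<Rightarrow> ('h \<Rightarrow> 'g) set" where
  "operator_class \<phi> \<psi> l d =
     {T \<in> diag_operators \<phi> \<psi>.
        \<forall>j\<ge>1. 1 / d \<le> (sing_val \<phi> \<psi> T j)\<^sup>2 / l j \<and> (sing_val \<phi> \<psi> T j)\<^sup>2 / l j \<le> d}"

section \<open>Auxiliary quantities\<close>

definition Delta :: "(nat \<Rightarrow> real) \<Rightarrow> (nat \<Rightarrow> real) \<Rightarrow> nat \<Rightarrow> real" where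
  "Delta w \<alpha> k = Max ((\<lambda>j. w j / (\<alpha> j)\<^sup>2) ` {1..k})"

definition delta :: "(nat \<Rightarrow> real) \<Rightarrow> (nat \<Rightarrow> real) \<Rightarrow> nat \<Rightarrow> real" where
  "delta w \<alpha> k =
     real k * Delta w \<alpha> k * (ln (max (Delta w \<alpha> k) (real k + 2)) / ln (real k + 2))"

definition run_max :: "(nat \<Rightarrow> real) \<Rightarrow> nat \<Rightarrow> real" where
  "run_max w k = Max (w ` {1..k})"

definition N_max :: "(nat \<Rightarrow> real) \<Rightarrow> real \<Rightarrow> nat" where
  "N_max w \<epsilon> = Max {N. 1 \<le> N \<and> real N \<le> 1 / \<epsilon> \<and> run_max w N \<le> 1 / \<epsilon>}"

definition v_exp :: "real \<Rightarrow> real" where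
  "v_exp \<sigma> = 1 / (8 * ln (ln (1 / \<sigma> + 20)))"

definition N_idx :: "(nat \<Rightarrow> real) \<Rightarrow> real \<Rightarrow> (nat \<Rightarrow> real) \<Rightarrow> nat" where
  "N_idx w \<epsilon> \<alpha> =
     (let S = {j. 2 \<le> j \<and> j \<le> N_max w \<epsilon> \<and> (\<alpha> j)\<^sup>2 / (real j * run_max w j) \<le> \<epsilon> * \<bar>ln \<epsilon>\<bar>}
      in if S = {} then N_max w \<epsilon> else Min S - 1)"

definition M_idx :: "real \<Rightarrow> (nat \<Rightarrow> real) \<Rightarrow> nat" where
  "M_idx \<sigma> \<alpha> =
     (let S = {j. 2 \<le> j \<and> real j \<le> 1 / \<sigma> \<and> (\<alpha> j)\<^sup>2 \<le> \<sigma> powr (1 - v_exp \<sigma>)}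
      in if S = {} then nat \<lfloor>1 / \<sigma>\<rfloor> else Min S - 1)"

definition K_idx :: "(nat \<Rightarrow> real) \<Rightarrow> real \<Rightarrow> real \<Rightarrow> (nat \<Rightarrow> real) \<Rightarrow> nat" where
  "K_idx w \<epsilon> \<sigma> \<alpha> = min (N_idx w \<epsilon> \<alpha>) (M_idx \<sigma> \<alpha>)"

text \<open>
  The supremum is a maximum when the weight ratio is non-increasing and \<open>l\<close> tends to 0: the second
  factor is eventually 1.
\<close>
definition upsilon :: "(nat \<Rightarrow> real) \<Rightarrow> (nat \<Rightarrow> real) \<Rightarrow> (nat \<Rightarrow> real) \<Rightarrow> real \<Rightarrow> real" where
  "upsilon w \<gamma> l \<sigma> = (SUP k\<in>{1..}. w k / \<gamma> k * min 1 (\<sigma> / l k))"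

section \<open>Model and adaptive estimator\<close>

definition obs_Y ::
  "(nat \<Rightarrow> 'h::real_inner) \<Rightarrow> (nat \<Rightarrow> 'g::real_inner) \<Rightarrow> real \<Rightarrow> (nat \<Rightarrow> 's \<Rightarrow> real)
     \<Rightarrow> 'h \<Rightarrow> ('h \<Rightarrow> 'g) \<Rightarrow> 's \<Rightarrow> nat \<Rightarrow> real" where
  "obs_Y \<phi> \<psi> \<epsilon> \<xi> f T x j = sing_val \<phi> \<psi> T j * coeff_of \<phi> f j + sqrt \<epsilon> * \<xi> j x"

definition obs_X ::
  "(nat \<Rightarrow> 'h::real_inner) \<Rightarrow> (nat \<Rightarrow> 'g::real_inner) \<Rightarrow> real \<Rightarrow> (nat \<Rightarrow> 's \<Rightarrow> real)
     \<Rightarrow> ('h \<Rightarrow> 'g) \<Rightarrow> 's \<Rightarrow> nat \<Rightarrow> real" where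
  "obs_X \<phi> \<psi> \<sigma> \<zeta> T x j = sing_val \<phi> \<psi> T j + sqrt \<sigma> * \<zeta> j x"

definition std_normal_noise ::
  "'s measure \<Rightarrow> (nat \<Rightarrow> 's \<Rightarrow> real) \<Rightarrow> (nat \<Rightarrow> 's \<Rightarrow> real) \<Rightarrow> bool" where
  "std_normal_noise M \<xi> \<zeta> \<longleftrightarrow>
     prob_space M \<and>
     prob_space.indep_vars M (\<lambda>_. borel) (case_sum \<xi> \<zeta>) ({1..} <+> {1..}) \<and>
     (\<forall>j\<ge>1. distributed M lborel (\<xi> j) std_normal_density \<and>
             distributed M lborel (\<zeta> j) std_normal_density)"

text \<open>The estimators are functions of the observed sequences \<open>Y\<close> and \<open>X\<close> (one realisation).\<close>

definition f_hat ::
  "(nat \<Rightarrow> 'h::real_inner) \<Rightarrow> real \<Rightarrow> (nat \<Rightarrow> real) \<Rightarrow> (nat \<Rightarrow> real) \<Rightarrow> nat \<Rightarrow> 'h" where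
  "f_hat \<phi> \<sigma> Y X k = (\<Sum>j=1..k. (if (X j)\<^sup>2 \<ge> \<sigma> then Y j / X j else 0) *\<^sub>R \<phi> j)"

definition pen_hat :: "(nat \<Rightarrow> real) \<Rightarrow> real \<Rightarrow> (nat \<Rightarrow> real) \<Rightarrow> nat \<Rightarrow> real" where
  "pen_hat w \<epsilon> X k = 600 * delta w X k * \<epsilon>"

text \<open>\<^const>\<open>enn2real\<close> is harmless: the difference of estimators has finitely many nonzero coefficients.\<close>
definition con_hat ::
  "(nat \<Rightarrow> 'h::real_inner) \<Rightarrow> (nat \<Rightarrow> real) \<Rightarrow> real \<Rightarrow> real
     \<Rightarrow> (nat \<Rightarrow> real) \<Rightarrow> (nat \<Rightarrow> real) \<Rightarrow> nat \<Rightarrow> real" where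
  "con_hat \<phi> w \<epsilon> \<sigma> Y X k =
     Max ((\<lambda>j. enn2real (wnorm_sq \<phi> w (f_hat \<phi> \<sigma> Y X j - f_hat \<phi> \<sigma> Y X k)) - pen_hat w \<epsilon> X j)
          ` {k..K_idx w \<epsilon> \<sigma> X})"

definition k_hat ::
  "(nat \<Rightarrow> 'h::real_inner) \<Rightarrow> (nat \<Rightarrow> real) \<Rightarrow> real \<Rightarrow> real
     \<Rightarrow> (nat \<Rightarrow> real) \<Rightarrow> (nat \<Rightarrow> real) \<Rightarrow> nat" where
  "k_hat \<phi> w \<epsilon> \<sigma> Y X =
     (LEAST k. is_arg_min (\<lambda>i. con_hat \<phi> w \<epsilon> \<sigma> Y X i + pen_hat w \<epsilon> X i)
                 (\<lambda>i. i \<in> {1..K_idx w \<epsilon> \<sigma> X}) k)"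

definition adaptive_est ::
  "(nat \<Rightarrow> 'h::real_inner) \<Rightarrow> (nat \<Rightarrow> real) \<Rightarrow> real \<Rightarrow> real
     \<Rightarrow> (nat \<Rightarrow> real) \<Rightarrow> (nat \<Rightarrow> real) \<Rightarrow> 'h" where
  "adaptive_est \<phi> w \<epsilon> \<sigma> Y X = f_hat \<phi> \<sigma> Y X (k_hat \<phi> w \<epsilon> \<sigma> Y X)"

definition risk ::
  "(nat \<Rightarrow> 'h::real_inner) \<Rightarrow> (nat \<Rightarrow> 'g::real_inner) \<Rightarrow> 's measure \<Rightarrow> (nat \<Rightarrow> 's \<Rightarrow> real)
     \<Rightarrow> (nat \<Rightarrow> 's \<Rightarrow> real) \<Rightarrow> (nat \<Rightarrow> real) \<Rightarrow> real \<Rightarrow> real \<Rightarrow> 'h \<Rightarrow> ('h \<Rightarrow> 'g) \<Rightarrow> ennreal" where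
  "risk \<phi> \<psi> M \<xi> \<zeta> w \<epsilon> \<sigma> f T =
     (\<integral>\<^sup>+x. wnorm_sq \<phi> w
        (adaptive_est \<phi> w \<epsilon> \<sigma> (obs_Y \<phi> \<psi> \<epsilon> \<xi> f T x) (obs_X \<phi> \<psi> \<sigma> \<zeta> T x) - f) \<partial>M)"

end

theory Submission
  imports Defs
begin

text \<open>
  The selection rule is penalised contrast minimisation in disguise. The estimators
  \<open>f_hat k\<close> are partial sums of one orthogonal series, so squared distances between them are differences
  of squared norms, and \<open>k_hat\<close> turns out to be the first global minimiser of
  \<open>pen_hat k\<close> minus the squared norm of \<open>f_hat k\<close>
  (\<open>comparison_selects_contrast_minimiser\<close>). Split each estimated coefficient into the true
  one, a noise part caused by \<open>\<xi>\<close>, and a drift caused by the error in the singular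
  value. The usual argument for penalised contrasts then bounds the loss, for every admissible
  \<open>k\<close>, by a multiple of the bias at \<open>k\<close>, the penalty at \<open>k\<close>, the
  drift, and the excess of the noise over the penalty (\<open>oracle_inequality\<close>).

  The excess of the noise is bounded by \<open>4 * \<epsilon> * (\<Sum>l. exp (Q l / 4 - l))\<close> with \<open>Q l\<close> the sum of the
  first \<open>l\<close> squared \<open>\<xi> j\<close>; the logarithm in the penalty absorbs the size of the observed weights, so
  the bound holds uniformly in \<open>X\<close>
  (\<open>noise_le_penalty_plus_exp\<close>). Since \<open>exp (\<xi>\<^sup>2 / 4)\<close> has mean \<open>sqrt 2 < e\<close>, the expected sum converges.
  The drift in coordinate \<open>j\<close> is of order \<open>min 1 (\<sigma> / lam j)\<close> times the squared coefficient, hence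
  its weighted sum is of order \<open>r\<close> times \<open>upsilon\<close> (\<open>drift_le\<close>).

  These bounds need the observed \<open>X j\<close> within a factor 2 of the singular values up to one step past
  the bound \<open>M_idx\<close> for \<open>sqrt (4 * d * lam)\<close>. On that event the random bound on the dimension lies
  between its two deterministic counterparts (\<open>K_idx_sandwich\<close>). Off it, the
  loss is polynomial in \<open>1 / \<sigma>\<close> (\<open>loss_crude\<close>), while the tail hypothesis on \<open>lam\<close> makes
  the probability at most of order \<open>\<sigma> ^ 6\<close> (\<open>failure_mean_le\<close>); the product contributes
  a multiple of \<open>(1 + r) * \<sigma>\<close>.

  The argument is carried out for a fixed realisation and yields an upper bound for the loss that is a
  nonnegative combination of the variables \<open>exp (\<xi>\<^sup>2 / 4)\<close>, \<open>exp (\<zeta>\<^sup>2 / 4)\<close> and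
  \<open>exp (Q l / 4 - l)\<close> (\<open>adaptive_loss_envelope\<close>). Only this bound is integrated.
\<close>

section \<open>Selection by penalised comparison\<close>

text \<open>
  If \<open>V k\<close> is the squared norm of the \<open>k\<close>-th estimator, then \<open>V j - V k\<close> is the squared distance
  between two nested estimators, and \<open>con k + p k\<close> is the largest excess of the penalised contrast
  \<open>p - V\<close> at \<open>k\<close> over its values at the indices from \<open>k\<close> on. It is nonnegative and vanishes at \<open>K\<close>; so it
  vanishes at its first minimiser, which is therefore the first index not improved upon later, that
  is, the first global minimiser of the penalised contrast.
\<close>

lemma comparison_selects_contrast_minimiser:
  fixes V p con :: "nat \<Rightarrow> real"
  assumes K: "1 \<le> K"
    and con: "\<And>k. k \<in> {1..K} \<Longrightarrow> con k = Max ((\<lambda>j. V j - V k - p j) ` {k..K})"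
    and kh: "kh = (LEAST k. is_arg_min (\<lambda>i. con i + p i) (\<lambda>i. i \<in> {1..K}) k)"
  shows "kh \<in> {1..K}" and "k \<in> {1..K} \<Longrightarrow> p kh - V kh \<le> p k - V k"
proof -
  let ?arg = "is_arg_min (\<lambda>i. con i + p i) (\<lambda>i. i \<in> {1..K})"
  have con_ge: "V j - V k - p j \<le> con k" if "k \<in> {1..K}" "j \<in> {k..K}" for j k
    unfolding con[OF that(1)] using that by (intro Max_ge) auto
  have con_le: "con k \<le> c" if "k \<in> {1..K}" "\<And>j. j \<in> {k..K} \<Longrightarrow> V j - V k - p j \<le> c" for k c
    unfolding con[OF that(1)] using that by (intro Max.boundedI) auto
  have nonneg: "0 \<le> con k + p k" if "k \<in> {1..K}" for k
    using con_ge[OF that, of k] that by auto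
  have arg_min_if: "?arg i" if i: "i \<in> {1..K}" and best: "\<And>j. j \<in> {i..K} \<Longrightarrow> p i - V i \<le> p j - V j" for i
  proof -
    have "con i \<le> - p i"
      using best by (intro con_le[OF i]) fastforce
    then show ?thesis
      unfolding is_arg_min_linorder using i nonneg by fastforce
  qed
  have argK: "?arg K"
    using K by (intro arg_min_if) auto
  have arg_kh: "?arg kh"
    unfolding kh using argK by (rule LeastI)
  then show kh_in: "kh \<in> {1..K}"
    by (simp add: is_arg_min_linorder)
  \<comment> \<open>\<open>K\<close> is itself a minimiser, with value at most 0.\<close>
  have "con K \<le> - p K"
    using K by (intro con_le) auto
  then have kh_zero: "con kh + p kh \<le> 0"
    using arg_kh K unfolding is_arg_min_linorder by (auto dest!: spec[of _ K])
  have kh_best: "p kh - V kh \<le> p j - V j" if "j \<in> {kh..K}" for j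
    using con_ge[OF kh_in that] kh_zero by linarith
  assume k: "k \<in> {1..K}"
  obtain i where i: "i \<in> {1..K}" "\<And>j. j \<in> {1..K} \<Longrightarrow> p i - V i \<le> p j - V j"
    using ex_is_arg_min_if_finite[of "{1..K}" "\<lambda>j. p j - V j"] K
    unfolding is_arg_min_linorder by force
  have "?arg i"
    using i by (intro arg_min_if) auto
  then have "kh \<le> i"
    unfolding kh by (rule Least_le)
  then show "p kh - V kh \<le> p k - V k"
    using kh_best[of i] i(1) i(2)[OF k] by auto
qed

text \<open>
  An index \<open>kh\<close> not worse than \<open>k\<close> for the penalised contrast loses at most a multiple of the
  trade-off at \<open>k\<close>. If \<open>kh \<le> k\<close>, the coordinates lost between \<open>kh\<close> and \<open>k\<close> have estimated energy at
  most \<open>p k\<close>. If \<open>k < kh\<close>, the penalty \<open>p kh\<close> is at most \<open>p k\<close> plus the estimated energy between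
  \<open>k\<close> and \<open>kh\<close>; half of \<open>p kh\<close> pays for the noise in that energy, which leaves a bound
  on \<open>p kh\<close> itself, hence on the variance at \<open>kh\<close>. The estimated coefficients are \<open>f + u + b\<close>.
\<close>

lemma oracle_inequality:
  fixes w f u b p :: "nat \<Rightarrow> real"
  assumes w: "\<And>j. 1 \<le> j \<Longrightarrow> 0 \<le> w j"
    and kh: "kh \<in> {1..K}" and k: "k \<in> {1..K}"
    and select: "p kh - (\<Sum>j=1..kh. w j * (f j + u j + b j)\<^sup>2)
                   \<le> p k - (\<Sum>j=1..k. w j * (f j + u j + b j)\<^sup>2)"
    and p: "0 \<le> p k" "0 \<le> p kh"
    and noise: "\<And>l. l \<in> {1..K} \<Longrightarrow> (\<Sum>j=1..l. w j * (u j)\<^sup>2) \<le> p l / 6 + R"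
    and R: "0 \<le> R"
    and drift: "(\<Sum>j=1..K. w j * (b j)\<^sup>2) \<le> B"
    and bias: "\<And>m. (\<Sum>j\<in>{k<..m}. w j * (f j)\<^sup>2) \<le> D"
    and m: "K \<le> m"
  shows "(\<Sum>j=1..m. w j * ((if j \<le> kh then f j + u j + b j else 0) - f j)\<^sup>2) \<le> 3 * p k + 4 * R + 4 * B + 3 * D"
proof -
  let ?g = "\<lambda>j. w j * (f j + u j + b j)\<^sup>2"
  let ?e = "\<lambda>j. w j * (u j + b j)\<^sup>2"
  let ?f = "\<lambda>j. w j * (f j)\<^sup>2"
  let ?u = "\<lambda>j. w j * (u j)\<^sup>2"
  let ?b = "\<lambda>j. w j * (b j)\<^sup>2"
  have split: "sum h {1..j} = sum h {1..i} + sum h {i<..j}" if "i \<le> j" for h :: "nat \<Rightarrow> real" and i j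
  proof -
    have "{1..j} = {1..i} \<union> {i<..j}" using that by auto
    then show ?thesis by (simp add: sum.union_disjoint ivl_disj_int)
  qed
  have error: "sum ?e {1..l} \<le> 2 * sum ?u {1..l} + 2 * B" if "l \<in> {1..K}" for l
  proof -
    have "?e j \<le> 2 * ?u j + 2 * ?b j" if "j \<in> {1..l}" for j
    proof -
      have "(u j + b j)\<^sup>2 \<le> 2 * (u j)\<^sup>2 + 2 * (b j)\<^sup>2"
        using zero_le_power2[of "u j - b j"] by (simp add: power2_eq_square algebra_simps)
      from mult_left_mono[OF this w[of j]] that show ?thesis by (simp add: algebra_simps)
    qed
    then have "sum ?e {1..l} \<le> (\<Sum>j=1..l. 2 * ?u j + 2 * ?b j)" by (rule sum_mono)
    also have "\<dots> = 2 * sum ?u {1..l} + 2 * sum ?b {1..l}"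
      by (simp add: sum.distrib sum_distrib_left)
    also have "sum ?b {1..l} \<le> sum ?b {1..K}"
      using that w by (intro sum_mono2) auto
    finally show ?thesis using drift by linarith
  qed
  have loss: "(\<Sum>j=1..m. w j * ((if j \<le> kh then f j + u j + b j else 0) - f j)\<^sup>2)
      = sum ?e {1..kh} + sum ?f {kh<..m}"
  proof -
    have "(\<Sum>j=1..kh. w j * ((if j \<le> kh then f j + u j + b j else 0) - f j)\<^sup>2) = sum ?e {1..kh}"
      by (intro sum.cong) auto
    moreover have "(\<Sum>j\<in>{kh<..m}. w j * ((if j \<le> kh then f j + u j + b j else 0) - f j)\<^sup>2) = sum ?f {kh<..m}"
      by (intro sum.cong) auto
    ultimately show ?thesis using split[of kh m] kh m by auto
  qed
  show ?thesis
  proof (cases "kh \<le> k")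
    case True
    have "sum ?f {kh<..k} \<le> (\<Sum>j\<in>{kh<..k}. 2 * ?g j + 2 * ?e j)"
    proof (rule sum_mono)
      fix j assume "j \<in> {kh<..k}"
      then have "0 \<le> w j" using w by auto
      have "(f j)\<^sup>2 \<le> 2 * (f j + u j + b j)\<^sup>2 + 2 * (u j + b j)\<^sup>2"
        using zero_le_power2[of "f j + 2 * (u j + b j)"] by (simp add: power2_eq_square algebra_simps)
      from mult_left_mono[OF this \<open>0 \<le> w j\<close>] show "?f j \<le> 2 * ?g j + 2 * ?e j"
        by (simp add: algebra_simps)
    qed
    also have "\<dots> = 2 * sum ?g {kh<..k} + 2 * sum ?e {kh<..k}"
      by (simp add: sum.distrib sum_distrib_left)
    also have "sum ?g {kh<..k} \<le> p k"
      using select p split[OF True, of ?g] by linarith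
    finally have lost: "sum ?f {kh<..k} \<le> 2 * p k + 2 * sum ?e {kh<..k}" by simp
    have "0 \<le> sum ?e {1..kh}"
      using w by (intro sum_nonneg) auto
    then have e: "sum ?e {1..kh} + 2 * sum ?e {kh<..k} \<le> 2 * sum ?e {1..k}"
      using split[OF True, of ?e] by linarith
    have "sum ?f {kh<..m} = sum ?f {kh<..k} + sum ?f {k<..m}"
      using split[of kh m ?f] split[of k m ?f] split[OF True, of ?f] True k m by auto
    then show ?thesis
      unfolding loss using lost e error[OF k] noise[OF k] bias[of m] sum_nonneg[of "{k<..m}" ?f] w p R
      by auto
  next
    case False
    then have le: "k \<le> kh" by simp
    have "sum ?g {k<..kh} \<le> (\<Sum>j\<in>{k<..kh}. 3 * ?f j + (3 * ?u j + 3 * ?b j))"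
    proof (rule sum_mono)
      fix j assume "j \<in> {k<..kh}"
      then have "0 \<le> w j" using w by auto
      have "(f j + u j + b j)\<^sup>2 \<le> 3 * (f j)\<^sup>2 + (3 * (u j)\<^sup>2 + 3 * (b j)\<^sup>2)"
        using zero_le_power2[of "f j - u j"] zero_le_power2[of "u j - b j"] zero_le_power2[of "f j - b j"]
        by (simp add: power2_eq_square algebra_simps)
      from mult_left_mono[OF this \<open>0 \<le> w j\<close>] show "?g j \<le> 3 * ?f j + (3 * ?u j + 3 * ?b j)"
        by (simp add: algebra_simps)
    qed
    also have "\<dots> = 3 * sum ?f {k<..kh} + (3 * sum ?u {k<..kh} + 3 * sum ?b {k<..kh})"
      by (simp add: sum.distrib sum_distrib_left)
    finally have "sum ?g {k<..kh} \<le> 3 * sum ?f {k<..kh} + (3 * sum ?u {k<..kh} + 3 * sum ?b {k<..kh})" .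
    moreover have "sum ?u {k<..kh} \<le> sum ?u {1..kh}"
      using w by (intro sum_mono2) auto
    moreover have "sum ?b {k<..kh} \<le> sum ?b {1..K}"
      using w kh by (intro sum_mono2) auto
    ultimately have "sum ?g {k<..kh} \<le> 3 * D + 3 * (p kh / 6 + R) + 3 * B"
      using bias[of kh] noise[OF kh] drift by argo
    then have "p kh \<le> 2 * p k + 6 * D + 6 * R + 6 * B"
      using select split[OF le, of ?g] by argo
    moreover have "sum ?f {kh<..m} \<le> sum ?f {k<..m}"
      using le w by (intro sum_mono2) auto
    ultimately show ?thesis
      unfolding loss using error[OF kh] noise[OF kh] bias[of m] p by linarith
  qed
qed

section \<open>Weighted norms and coordinates\<close>

lemma wnorm_sq_eq_SUP:
  assumes "\<And>j. 1 \<le> j \<Longrightarrow> 0 \<le> w j"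
  shows "wnorm_sq \<phi> w h = (SUP m. ennreal (\<Sum>j=1..m. w j * (coeff_of \<phi> h j)\<^sup>2))"
  unfolding wnorm_sq_def suminf_eq_SUP using assms
  by (simp add: sum_ennreal sum.atLeast1_atMost_eq)

lemma wnorm_sq_leI:
  assumes w: "\<And>j. 1 \<le> j \<Longrightarrow> 0 \<le> w j"
    and bound: "\<And>m. n \<le> m \<Longrightarrow> (\<Sum>j=1..m. w j * (coeff_of \<phi> h j)\<^sup>2) \<le> c"
  shows "wnorm_sq \<phi> w h \<le> ennreal c"
proof (subst wnorm_sq_eq_SUP, erule w, intro SUP_least ennreal_leI)
  fix m
  have "(\<Sum>j=1..m. w j * (coeff_of \<phi> h j)\<^sup>2) \<le> (\<Sum>j=1..max n m. w j * (coeff_of \<phi> h j)\<^sup>2)"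
    using w by (intro sum_mono2) auto
  also have "\<dots> \<le> c" by (rule bound) simp
  finally show "(\<Sum>j=1..m. w j * (coeff_of \<phi> h j)\<^sup>2) \<le> c" .
qed

lemma wnorm_sq_leD:
  assumes w: "\<And>j. 1 \<le> j \<Longrightarrow> 0 \<le> w j"
    and h: "wnorm_sq \<phi> w h \<le> ennreal c" and c: "0 \<le> c"
  shows "(\<Sum>j=1..m. w j * (coeff_of \<phi> h j)\<^sup>2) \<le> c"
proof -
  have "ennreal (\<Sum>j=1..m. w j * (coeff_of \<phi> h j)\<^sup>2) \<le> wnorm_sq \<phi> w h"
    by (subst wnorm_sq_eq_SUP, erule w, rule SUP_upper, simp)
  then show ?thesis using h c by (metis ennreal_le_iff order_trans)
qed

lemma sing_val_eq:
  assumes "orthonormal_seq \<psi>" "1 \<le> j" "T (\<phi> j) = a *\<^sub>R \<psi> j"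
  shows "sing_val \<phi> \<psi> T j = a"
proof -
  have "\<psi> j \<noteq> 0"
    using assms(1,2) unfolding orthonormal_seq_def by fastforce
  then show ?thesis
    unfolding sing_val_def using assms(3) by (intro the_equality) auto
qed

lemma sing_val_pos:
  assumes "orthonormal_seq \<psi>" "T \<in> operator_class \<phi> \<psi> l d" "1 \<le> j"
  shows "0 < sing_val \<phi> \<psi> T j"
proof -
  obtain a where "\<And>j. 1 \<le> j \<Longrightarrow> 0 < a j \<and> T (\<phi> j) = a j *\<^sub>R \<psi> j"
    using assms(2) unfolding operator_class_def diag_operators_def by auto
  then show ?thesis using sing_val_eq[OF assms(1,3)] assms(3) by metis
qed

definition thresholded_quotient :: "real \<Rightarrow> (nat \<Rightarrow> real) \<Rightarrow> (nat \<Rightarrow> real) \<Rightarrow> nat \<Rightarrow> real" where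
  "thresholded_quotient \<sigma> Y X j = (if (X j)\<^sup>2 \<ge> \<sigma> then Y j / X j else 0)"

lemma coeff_of_f_hat:
  assumes "orthonormal_seq \<phi>" "1 \<le> i"
  shows "coeff_of \<phi> (f_hat \<phi> \<sigma> Y X k) i = (if i \<le> k then thresholded_quotient \<sigma> Y X i else 0)"
proof -
  have "coeff_of \<phi> (f_hat \<phi> \<sigma> Y X k) i
      = (\<Sum>j=1..k. thresholded_quotient \<sigma> Y X j * (\<phi> j \<bullet> \<phi> i))"
    unfolding coeff_of_def f_hat_def thresholded_quotient_def by (simp add: inner_sum_left)
  also have "\<dots> = (\<Sum>j=1..k. if j = i then thresholded_quotient \<sigma> Y X j else 0)"
    using assms unfolding orthonormal_seq_def by (intro sum.cong) auto
  also have "\<dots> = (if i \<le> k then thresholded_quotient \<sigma> Y X i else 0)"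
    using assms(2) by (simp add: sum.delta)
  finally show ?thesis .
qed

lemma wnorm_sq_f_hat_diff:
  fixes X Y :: "nat \<Rightarrow> real" and \<sigma> :: real
  assumes \<phi>: "orthonormal_seq \<phi>" and w: "\<And>j. 1 \<le> j \<Longrightarrow> 0 \<le> w j" and kl: "k \<le> l"
  defines "c \<equiv> thresholded_quotient \<sigma> Y X"
  shows "enn2real (wnorm_sq \<phi> w (f_hat \<phi> \<sigma> Y X l - f_hat \<phi> \<sigma> Y X k))
      = (\<Sum>j=1..l. w j * (c j)\<^sup>2) - (\<Sum>j=1..k. w j * (c j)\<^sup>2)"
proof -
  let ?h = "f_hat \<phi> \<sigma> Y X l - f_hat \<phi> \<sigma> Y X k"
  have coeff: "coeff_of \<phi> ?h j = (if j \<in> {k<..l} then c j else 0)" if "1 \<le> j" for j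
    using coeff_of_f_hat[OF \<phi> that, of \<sigma> Y X] kl
    by (auto simp: coeff_of_def inner_diff_left c_def)
  have "wnorm_sq \<phi> w ?h = (\<Sum>j<l. ennreal (w (Suc j) * (coeff_of \<phi> ?h (Suc j))\<^sup>2))"
    unfolding wnorm_sq_def by (intro suminf_finite) (auto simp: coeff)
  also have "\<dots> = ennreal (\<Sum>j=1..l. w j * (coeff_of \<phi> ?h j)\<^sup>2)"
    using w by (simp add: sum_ennreal sum.atLeast1_atMost_eq)
  finally have "enn2real (wnorm_sq \<phi> w ?h) = (\<Sum>j=1..l. w j * (coeff_of \<phi> ?h j)\<^sup>2)"
    using w by (simp only:, intro enn2real_ennreal sum_nonneg mult_nonneg_nonneg) auto
  also have "\<dots> = (\<Sum>j\<in>{1..k} \<union> {k<..l}. if j \<in> {k<..l} then w j * (c j)\<^sup>2 else 0)"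
    using kl by (intro sum.cong) (auto simp: coeff)
  also have "\<dots> = (\<Sum>j\<in>{k<..l}. w j * (c j)\<^sup>2)"
    by (subst sum.union_disjoint) (auto simp: ivl_disj_int)
  also have "\<dots> = (\<Sum>j\<in>{1..k} \<union> {k<..l}. w j * (c j)\<^sup>2) - (\<Sum>j=1..k. w j * (c j)\<^sup>2)"
    by (subst sum.union_disjoint) (auto simp: ivl_disj_int)
  also have "{1..k} \<union> {k<..l} = {1..l}" using kl by auto
  finally show ?thesis .
qed

section \<open>The dimension bounds\<close>

lemma le_stopping_index_iff:
  fixes n k :: nat and P :: "nat \<Rightarrow> bool"
  assumes "1 \<le> k"
  defines "S \<equiv> {j. 2 \<le> j \<and> j \<le> n \<and> P j}"
  shows "k \<le> (if S = {} then n else Min S - 1) \<longleftrightarrow> k \<le> n \<and> (\<forall>j\<in>{2..k}. \<not> P j)"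
proof (cases "S = {}")
  case True
  then show ?thesis unfolding S_def by auto
next
  case False
  have fin: "finite S" by (rule finite_subset[of _ "{..n}"]) (auto simp: S_def)
  have "Min S \<in> S" using fin False by (rule Min_in)
  then have "k \<le> Min S - 1 \<longleftrightarrow> k < Min S" using assms(1) by (auto simp: S_def)
  also have "\<dots> \<longleftrightarrow> (\<forall>j\<in>S. k < j)" using fin False by simp
  also have "\<dots> \<longleftrightarrow> k \<le> n \<and> (\<forall>j\<in>{2..k}. \<not> P j)"
  proof safe
    assume later: "\<forall>j\<in>S. k < j"
    show "k \<le> n" using later \<open>Min S \<in> S\<close> unfolding S_def by force
    fix j assume "j \<in> {2..k}" "P j"
    then have "j \<in> S" using \<open>k \<le> n\<close> by (simp add: S_def)
    then show False using later \<open>j \<in> {2..k}\<close> by fastforce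
  next
    fix j assume none: "\<forall>j\<in>{2..k}. \<not> P j" and "j \<in> S"
    then have "2 \<le> j" "P j" by (simp_all add: S_def)
    then show "k < j" using bspec[OF none, of j] by (cases "j \<le> k") simp_all
  qed
  finally show ?thesis using False by simp
qed

lemma le_M_idx_iff:
  assumes "0 < \<sigma>" "1 \<le> k"
  shows "k \<le> M_idx \<sigma> \<alpha> \<longleftrightarrow>
    real k \<le> 1 / \<sigma> \<and> (\<forall>j\<in>{2..k}. \<not> (\<alpha> j)\<^sup>2 \<le> \<sigma> powr (1 - v_exp \<sigma>))"
proof -
  have floor: "real j \<le> 1 / \<sigma> \<longleftrightarrow> j \<le> nat \<lfloor>1 / \<sigma>\<rfloor>" for j
    using assms(1) by (simp add: le_nat_floor le_nat_iff le_floor_iff)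
  show ?thesis
    unfolding M_idx_def Let_def floor using le_stopping_index_iff[OF assms(2)] by simp
qed

lemma le_N_idx_iff:
  assumes "1 \<le> k"
  shows "k \<le> N_idx w \<epsilon> \<alpha> \<longleftrightarrow>
    k \<le> N_max w \<epsilon> \<and> (\<forall>j\<in>{2..k}. \<not> (\<alpha> j)\<^sup>2 / (real j * run_max w j) \<le> \<epsilon> * \<bar>ln \<epsilon>\<bar>)"
  unfolding N_idx_def Let_def using le_stopping_index_iff[OF assms] by simp

lemma
  fixes w :: "nat \<Rightarrow> real"
  assumes "\<epsilon> \<in> {0<..<1}" "w 1 = 1"
  shows N_max_ge_1: "1 \<le> N_max w \<epsilon>"
    and weight_le_up_to_N_max: "j \<in> {1..N_max w \<epsilon>} \<Longrightarrow> w j \<le> 1 / \<epsilon>"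
proof -
  let ?S = "{N. 1 \<le> N \<and> real N \<le> 1 / \<epsilon> \<and> run_max w N \<le> 1 / \<epsilon>}"
  have fin: "finite ?S"
    by (rule finite_subset[of _ "{..nat \<lfloor>1 / \<epsilon>\<rfloor>}"]) (auto simp: le_nat_floor)
  have one: "1 \<in> ?S"
    using assms by (auto simp: run_max_def)
  show "1 \<le> N_max w \<epsilon>"
    unfolding N_max_def using fin one by (rule Max_ge)
  have "N_max w \<epsilon> \<in> ?S"
    unfolding N_max_def using Max_in[OF fin] one by blast
  moreover assume "j \<in> {1..N_max w \<epsilon>}"
  then have "w j \<le> run_max w (N_max w \<epsilon>)"
    unfolding run_max_def by (intro Max_ge) auto
  ultimately show "w j \<le> 1 / \<epsilon>" by simp
qed

lemma M_idx_ge_1: "\<sigma> \<in> {0<..<1} \<Longrightarrow> 1 \<le> M_idx \<sigma> \<alpha>"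
  by (subst le_M_idx_iff) auto

lemma K_idx_ge_1:
  assumes "\<epsilon> \<in> {0<..<1}" "\<sigma> \<in> {0<..<1}" "w 1 = 1"
  shows "1 \<le> K_idx w \<epsilon> \<sigma> \<alpha>"
  unfolding K_idx_def using M_idx_ge_1[OF assms(2)] N_max_ge_1[where w = w, OF assms(1,3)]
  by (simp add: le_N_idx_iff)

lemma K_idx_le_inverse_noise:
  assumes "\<epsilon> \<in> {0<..<1}" "\<sigma> \<in> {0<..<1}" "w 1 = 1"
  shows "real (K_idx w \<epsilon> \<sigma> \<alpha>) \<le> 1 / \<sigma>"
  using le_M_idx_iff[of \<sigma> "K_idx w \<epsilon> \<sigma> \<alpha>" \<alpha>] K_idx_ge_1[where w = w, OF assms] assms(2)
  by (auto simp: K_idx_def)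

lemma weight_le_up_to_K_idx:
  assumes "\<epsilon> \<in> {0<..<1}" "\<sigma> \<in> {0<..<1}" "w 1 = 1" "j \<in> {1..K_idx w \<epsilon> \<sigma> \<alpha>}"
  shows "w j \<le> 1 / \<epsilon>"
  using le_N_idx_iff[of j w \<epsilon> \<alpha>] assms(4) weight_le_up_to_N_max[where w = w, OF assms(1,3)]
  by (auto simp: K_idx_def)

text \<open>
  Both stopping rules compare \<open>\<alpha>\<^sup>2\<close> with a deterministic threshold, so they are monotone in
  \<open>\<alpha>\<^sup>2\<close>. Control of \<open>X\<close> is needed only up to the first index past the larger deterministic
  bound, because the rule for \<open>M_idx\<close> stops the observed sequence there.
\<close>

lemma K_idx_sandwich:
  assumes \<epsilon>: "\<epsilon> \<in> {0<..<1}" and \<sigma>: "\<sigma> \<in> {0<..<1}" and w: "w 1 = 1" "\<And>j. 1 \<le> j \<Longrightarrow> 0 < w j"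
    and X: "\<And>j. j \<in> {1..Suc (M_idx \<sigma> \<beta>)} \<Longrightarrow> (\<alpha> j)\<^sup>2 \<le> (X j)\<^sup>2 \<and> (X j)\<^sup>2 \<le> (\<beta> j)\<^sup>2"
    and \<alpha>\<beta>: "\<And>j. 1 \<le> j \<Longrightarrow> (\<alpha> j)\<^sup>2 \<le> (\<beta> j)\<^sup>2"
  shows "K_idx w \<epsilon> \<sigma> \<alpha> \<le> K_idx w \<epsilon> \<sigma> X" and "K_idx w \<epsilon> \<sigma> X \<le> M_idx \<sigma> \<beta>"
proof -
  let ?t = "\<sigma> powr (1 - v_exp \<sigma>)"
  have \<sigma>0: "0 < \<sigma>" using \<sigma> by simp
  show "K_idx w \<epsilon> \<sigma> X \<le> M_idx \<sigma> \<beta>"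
  proof (rule ccontr)
    let ?k = "Suc (M_idx \<sigma> \<beta>)"
    assume "\<not> ?thesis"
    then have "?k \<le> M_idx \<sigma> X" by (simp add: K_idx_def)
    then have k: "real ?k \<le> 1 / \<sigma>" and "\<forall>j\<in>{2..?k}. \<not> (X j)\<^sup>2 \<le> ?t"
      using le_M_idx_iff[OF \<sigma>0, of ?k X] by auto
    moreover have "(X j)\<^sup>2 \<le> (\<beta> j)\<^sup>2" if "j \<in> {2..?k}" for j
      using X[of j] that by auto
    ultimately have "\<forall>j\<in>{2..?k}. \<not> (\<beta> j)\<^sup>2 \<le> ?t"
      by (meson order_trans)
    with k have "?k \<le> M_idx \<sigma> \<beta>"
      using le_M_idx_iff[OF \<sigma>0, of ?k \<beta>] by auto
    then show False by simp
  qed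
  let ?k = "K_idx w \<epsilon> \<sigma> \<alpha>"
  have k1: "1 \<le> ?k" by (rule K_idx_ge_1[where w = w, OF \<epsilon> \<sigma> w(1)])
  have "?k \<le> M_idx \<sigma> \<alpha>" "?k \<le> N_idx w \<epsilon> \<alpha>" by (simp_all add: K_idx_def)
  then have M: "real ?k \<le> 1 / \<sigma>" "\<forall>j\<in>{2..?k}. \<not> (\<alpha> j)\<^sup>2 \<le> ?t"
    and N: "?k \<le> N_max w \<epsilon>" "\<forall>j\<in>{2..?k}. \<not> (\<alpha> j)\<^sup>2 / (real j * run_max w j) \<le> \<epsilon> * \<bar>ln \<epsilon>\<bar>"
    using le_M_idx_iff[OF \<sigma>0 k1] le_N_idx_iff[OF k1] by auto
  have "?k \<le> M_idx \<sigma> \<beta>"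
    unfolding le_M_idx_iff[OF \<sigma>0 k1] using M \<alpha>\<beta>
    by (meson atLeastAtMost_iff order_trans one_le_numeral)
  then have X': "(\<alpha> j)\<^sup>2 \<le> (X j)\<^sup>2" if "j \<in> {2..?k}" for j
    using X[of j] that by auto
  have "(\<alpha> j)\<^sup>2 / (real j * run_max w j) \<le> (X j)\<^sup>2 / (real j * run_max w j)" if "j \<in> {2..?k}" for j
  proof -
    have "w 1 \<le> run_max w j"
      using that unfolding run_max_def by (intro Max_ge) auto
    then show ?thesis using w that X'[OF that] by (intro divide_right_mono) auto
  qed
  then have "?k \<le> N_idx w \<epsilon> X"
    unfolding le_N_idx_iff[OF k1] using N by (meson order_trans)
  moreover have "?k \<le> M_idx \<sigma> X"
    unfolding le_M_idx_iff[OF \<sigma>0 k1] using M X' by (meson order_trans)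
  ultimately show "?k \<le> K_idx w \<epsilon> \<sigma> X" by (simp add: K_idx_def)
qed

section \<open>The penalty and the noise\<close>

lemma weight_le_Delta: "j \<in> {1..k} \<Longrightarrow> w j / (\<alpha> j)\<^sup>2 \<le> Delta w \<alpha> k"
  unfolding Delta_def by (intro Max_ge) auto

lemma Delta_nonneg:
  assumes "1 \<le> k" "\<And>j. 1 \<le> j \<Longrightarrow> 0 \<le> w j"
  shows "0 \<le> Delta w \<alpha> k"
proof -
  have "0 \<le> w 1 / (\<alpha> 1)\<^sup>2" using assms by simp
  also have "\<dots> \<le> Delta w \<alpha> k" using assms by (intro weight_le_Delta) auto
  finally show ?thesis .
qed

lemma ln_add_2_ge_1: "1 \<le> ln (real k + 2)" if "1 \<le> k"
proof -
  have "exp (1::real) \<le> real k + 2" using exp_le that by simp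
  then show ?thesis by (subst ln_ge_iff) auto
qed

lemma delta_log_factor_ge_1:
  "1 \<le> k \<Longrightarrow> 1 \<le> ln (max (Delta w \<alpha> k) (real k + 2)) / ln (real k + 2)"
  using ln_add_2_ge_1[of k] by simp

lemma delta_nonneg:
  assumes "1 \<le> k" "\<And>j. 1 \<le> j \<Longrightarrow> 0 \<le> w j"
  shows "0 \<le> delta w \<alpha> k"
  unfolding delta_def using Delta_nonneg[OF assms] delta_log_factor_ge_1[OF assms(1), of w \<alpha>] by simp

lemma delta_le_mult:
  assumes k: "1 \<le> k" and w: "\<And>j. 1 \<le> j \<Longrightarrow> 0 \<le> w j" and c: "1 \<le> c"
    and \<beta>: "\<And>j. j \<in> {1..k} \<Longrightarrow> 0 < (\<beta> j)\<^sup>2 \<and> (\<beta> j)\<^sup>2 \<le> c * (\<alpha> j)\<^sup>2"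
  shows "delta w \<alpha> k \<le> c * (1 + ln c) * delta w \<beta> k"
proof -
  let ?A = "Delta w \<alpha> k" and ?B = "Delta w \<beta> k" and ?l = "ln (real k + 2)"
  have l: "1 \<le> ?l" by (rule ln_add_2_ge_1[OF k])
  have B: "0 \<le> ?B" by (rule Delta_nonneg[OF k w])
  have A: "0 \<le> ?A" by (rule Delta_nonneg[OF k w])
  have AB: "?A \<le> c * ?B"
    unfolding Delta_def[of w \<alpha>]
  proof (intro Max.boundedI)
    fix x assume "x \<in> (\<lambda>j. w j / (\<alpha> j)\<^sup>2) ` {1..k}"
    then obtain j where j: "j \<in> {1..k}" and x: "x = w j / (\<alpha> j)\<^sup>2" by auto
    have "0 < c * (\<alpha> j)\<^sup>2" using \<beta>[OF j] by linarith
    then have "x = c * (w j / (c * (\<alpha> j)\<^sup>2))" using c x by (simp add: field_simps)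
    also have "\<dots> \<le> c * (w j / (\<beta> j)\<^sup>2)"
      using \<beta>[OF j] w[of j] j c \<open>0 < c * (\<alpha> j)\<^sup>2\<close> by (intro mult_left_mono divide_left_mono mult_pos_pos) auto
    also have "\<dots> \<le> c * ?B"
      using weight_le_Delta[OF j, of w \<beta>] c by (intro mult_left_mono) auto
    finally show "x \<le> c * ?B" .
  qed (use k in auto)
  have "max ?A (real k + 2) \<le> c * max ?B (real k + 2)"
    using AB c by (smt (verit, best) max.cobounded1 max.cobounded2 mult_left_mono mult_left_le_one_le mult_le_cancel_right1 max_def of_nat_0_le_iff)
  then have "ln (max ?A (real k + 2)) \<le> ln (c * max ?B (real k + 2))"
    by (subst ln_le_cancel_iff) (use c in auto)
  also have "\<dots> = ln c + ln (max ?B (real k + 2))"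
    using c by (intro ln_mult_pos) auto
  also have "\<dots> \<le> (1 + ln c) * ln (max ?B (real k + 2))"
  proof -
    have "?l \<le> ln (max ?B (real k + 2))" by (subst ln_le_cancel_iff) auto
    then have "ln c * 1 \<le> ln c * ln (max ?B (real k + 2))"
      using l c by (intro mult_left_mono order_trans[OF l]) auto
    then show ?thesis by (simp add: algebra_simps)
  qed
  finally have ln_le: "ln (max ?A (real k + 2)) / ?l \<le> (1 + ln c) * (ln (max ?B (real k + 2)) / ?l)"
    using l by (simp add: divide_right_mono)
  have "delta w \<alpha> k \<le> real k * (c * ?B) * ((1 + ln c) * (ln (max ?B (real k + 2)) / ?l))"
    unfolding delta_def using AB A ln_le delta_log_factor_ge_1[OF k, of w \<alpha>] by (intro mult_mono) auto
  also have "\<dots> = c * (1 + ln c) * delta w \<beta> k"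
    unfolding delta_def by (simp add: algebra_simps)
  finally show ?thesis .
qed

text \<open>
  Write \<open>\<rho>\<close> for the logarithmic factor of the penalty and \<open>Q = \<Sum>j\<le>k. (z j)\<^sup>2\<close>. The noise is at most
  \<open>Delta * Q\<close>, and its excess over \<open>100 * k * \<rho> * Delta\<close> at most \<open>4 * Delta * exp (Q / 4 - 25 * k * \<rho>)\<close>.
  The factor \<open>\<rho>\<close> is made so that \<open>Delta \<le> (k + 2) powr \<rho> \<le> exp (24 * k * \<rho>)\<close>, which removes
  \<open>Delta\<close>: the excess is bounded by a quantity depending on \<open>z\<close> alone, uniformly in \<open>\<alpha>\<close>. So the
  bound survives the substitution of observed values for \<open>\<alpha>\<close>.
\<close>

lemma noise_le_penalty_plus_exp:
  assumes k: "1 \<le> k" and w: "\<And>j. 1 \<le> j \<Longrightarrow> 0 \<le> w j"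
  shows "(\<Sum>j=1..k. w j / (\<alpha> j)\<^sup>2 * (z j)\<^sup>2)
    \<le> 100 * delta w \<alpha> k + 4 * exp ((\<Sum>j=1..k. (z j)\<^sup>2) / 4 - real k)"
proof -
  define D where "D = Delta w \<alpha> k"
  define Q where "Q = (\<Sum>j=1..k. (z j)\<^sup>2)"
  define \<rho> where "\<rho> = ln (max D (real k + 2)) / ln (real k + 2)"
  have D: "0 \<le> D" unfolding D_def by (rule Delta_nonneg[OF k w])
  have \<rho>: "1 \<le> \<rho>" unfolding \<rho>_def D_def by (rule delta_log_factor_ge_1[OF k])
  have l: "1 \<le> ln (real k + 2)" by (rule ln_add_2_ge_1[OF k])
  have "ln (real k + 2) \<le> real k + 1" using ln_add_one_self_le_self[of "real k + 1"] by (simp add: add.commute)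
  then have "\<rho> * ln (real k + 2) \<le> \<rho> * (24 * real k)"
    using \<rho> k by (intro mult_left_mono) auto
  moreover have "\<rho> * ln (real k + 2) = ln (max D (real k + 2))"
    unfolding \<rho>_def using l by simp
  ultimately have "ln (max D (real k + 2)) \<le> 24 * real k * \<rho>"
    by (simp add: mult_ac)
  then have "exp (ln (max D (real k + 2))) \<le> exp (24 * real k * \<rho>)"
    by (subst exp_le_cancel_iff)
  moreover have "exp (ln (max D (real k + 2))) = max D (real k + 2)"
    by (intro exp_ln) auto
  ultimately have "max D (real k + 2) \<le> exp (24 * real k * \<rho>)"
    by metis
  then have D_exp: "D \<le> exp (24 * real k * \<rho>)" by simp
  have noise: "(\<Sum>j=1..k. w j / (\<alpha> j)\<^sup>2 * (z j)\<^sup>2) \<le> D * Q"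
    unfolding Q_def sum_distrib_left D_def using weight_le_Delta[of _ k w \<alpha>]
    by (intro sum_mono mult_right_mono) auto
  have "Q / 4 - 25 * real k * \<rho> \<le> exp (Q / 4 - 25 * real k * \<rho>)"
    by (meson exp_ge_add_one_self less_add_one less_eq_real_def order_trans add_increasing zero_le_one order_refl)
  then have "D * (Q - 100 * real k * \<rho>) \<le> D * (4 * exp (Q / 4 - 25 * real k * \<rho>))"
    using D by (intro mult_left_mono) auto
  also have "\<dots> \<le> exp (24 * real k * \<rho>) * (4 * exp (Q / 4 - 25 * real k * \<rho>))"
    using D_exp by (intro mult_right_mono) auto
  also have "\<dots> = 4 * exp (Q / 4 - real k * \<rho>)"
    by (simp flip: exp_add)
  also have "\<dots> \<le> 4 * exp (Q / 4 - real k)"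
    using \<rho> mult_left_mono[OF \<rho>, of "real k"] by simp
  finally have "D * Q \<le> 100 * (real k * D * \<rho>) + 4 * exp (Q / 4 - real k)"
    by (simp add: algebra_simps)
  then show ?thesis
    using noise unfolding delta_def Q_def \<rho>_def D_def by linarith
qed

text \<open>
  Together with the independence of the \<open>\<xi> j\<close>, this moment carries all the probability: tails and
  polynomial moments of the noise are dominated pointwise by \<open>exp (z\<^sup>2 / 4)\<close>. Its exact value is \<open>sqrt 2\<close>;
  what matters is that it is less than \<open>e\<close>.
\<close>

lemma std_normal_exp_moment:
  assumes "distributed M lborel Z std_normal_density"
  shows "(\<integral>\<^sup>+x. ennreal (exp ((Z x)\<^sup>2 / 4)) \<partial>M) \<le> ennreal (3 / 2)"
proof -
  have "(\<integral>\<^sup>+x. ennreal (exp ((Z x)\<^sup>2 / 4)) \<partial>M)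
      = (\<integral>\<^sup>+x. ennreal (std_normal_density x) * ennreal (exp (x\<^sup>2 / 4)) \<partial>lborel)"
    using distributed_nn_integral[OF assms, of "\<lambda>x. ennreal (exp (x\<^sup>2 / 4))"] by simp
  also have "\<dots> = (\<integral>\<^sup>+x. ennreal (sqrt 2) * ennreal (normal_density 0 (sqrt 2) x) \<partial>lborel)"
  proof (intro nn_integral_cong)
    fix x :: real
    have "std_normal_density x * exp (x\<^sup>2 / 4) = sqrt 2 * normal_density 0 (sqrt 2) x"
      unfolding normal_density_def
      by (simp add: real_sqrt_mult mult.assoc flip: exp_add) (simp add: field_simps)
    then show "ennreal (std_normal_density x) * ennreal (exp (x\<^sup>2 / 4))
        = ennreal (sqrt 2) * ennreal (normal_density 0 (sqrt 2) x)"
      by (simp flip: ennreal_mult)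
  qed
  also have "\<dots> = ennreal (sqrt 2) * (\<integral>\<^sup>+x. ennreal (normal_density 0 (sqrt 2) x) \<partial>lborel)"
    by (intro nn_integral_cmult) simp
  also have "(\<integral>\<^sup>+x. ennreal (normal_density 0 (sqrt 2) x) \<partial>lborel) = 1"
    using prob_space.emeasure_space_1[OF prob_space_normal_density[of "sqrt 2" 0]]
    by (simp add: emeasure_density)
  finally have "(\<integral>\<^sup>+x. ennreal (exp ((Z x)\<^sup>2 / 4)) \<partial>M) = ennreal (sqrt 2)" by simp
  also have "\<dots> \<le> ennreal (3 / 2)"
    by (intro ennreal_leI real_le_lsqrt) (auto simp: power2_eq_square)
  finally show ?thesis .
qed

context
  fixes M :: "'s measure" and \<xi> \<zeta> :: "nat \<Rightarrow> 's \<Rightarrow> real"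
  assumes noise: "std_normal_noise M \<xi> \<zeta>"
begin

lemma noise_distributed:
  assumes "1 \<le> j"
  shows "distributed M lborel (\<xi> j) std_normal_density" "distributed M lborel (\<zeta> j) std_normal_density"
  using noise assms unfolding std_normal_noise_def by metis+

lemma noise_measurable:
  assumes "1 \<le> j"
  shows "\<xi> j \<in> borel_measurable M" "\<zeta> j \<in> borel_measurable M"
  using noise_distributed[OF assms, THEN distributed_measurable] by simp_all

lemma noise_exp_moment:
  assumes "1 \<le> j"
  shows "(\<integral>\<^sup>+x. ennreal (exp ((\<xi> j x)\<^sup>2 / 4)) \<partial>M) \<le> ennreal (3 / 2)"
    and "(\<integral>\<^sup>+x. ennreal (exp ((\<zeta> j x)\<^sup>2 / 4)) \<partial>M) \<le> ennreal (3 / 2)"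
  by (intro std_normal_exp_moment noise_distributed assms)+

lemma noise_energy_exp_moment:
  "(\<integral>\<^sup>+x. ennreal (exp ((\<Sum>j=1..l. (\<xi> j x)\<^sup>2) / 4 - real l)) \<partial>M) \<le> ennreal ((3 / 4) ^ l)"
proof -
  have "prob_space M" using noise unfolding std_normal_noise_def by (rule conjunct1)
  then interpret prob_space M .
  let ?I = "Inl ` {1..l} :: (nat + nat) set"
  let ?e = "\<lambda>i x. ennreal (exp ((case_sum \<xi> \<zeta> i x)\<^sup>2 / 4))"
  have "indep_vars (\<lambda>_. borel) (case_sum \<xi> \<zeta>) ?I"
  proof (rule indep_vars_subset)
    show "indep_vars (\<lambda>_. borel) (case_sum \<xi> \<zeta>) ({1..} <+> {1..})"
      using noise unfolding std_normal_noise_def by (elim conjE)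
  qed auto
  then have "indep_vars (\<lambda>_. borel) ?e ?I"
    by (rule indep_vars_compose2) simp
  then have "(\<integral>\<^sup>+x. (\<Prod>i\<in>?I. ?e i x) \<partial>M) = (\<Prod>i\<in>?I. \<integral>\<^sup>+x. ?e i x \<partial>M)"
    by (intro indep_vars_nn_integral) auto
  then have prod: "(\<integral>\<^sup>+x. (\<Prod>j=1..l. ennreal (exp ((\<xi> j x)\<^sup>2 / 4))) \<partial>M)
      = (\<Prod>j=1..l. \<integral>\<^sup>+x. ennreal (exp ((\<xi> j x)\<^sup>2 / 4)) \<partial>M)"
    by (simp add: prod.reindex)
  have split: "ennreal (exp ((\<Sum>j=1..l. (\<xi> j x)\<^sup>2) / 4 - real l))
      = ennreal (exp (- real l)) * (\<Prod>j=1..l. ennreal (exp ((\<xi> j x)\<^sup>2 / 4)))" for x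
    by (simp add: prod_ennreal sum_divide_distrib exp_diff exp_minus field_simps flip: exp_sum ennreal_mult)
  have "(\<integral>\<^sup>+x. ennreal (exp ((\<Sum>j=1..l. (\<xi> j x)\<^sup>2) / 4 - real l)) \<partial>M)
      = ennreal (exp (- real l)) * (\<Prod>j=1..l. \<integral>\<^sup>+x. ennreal (exp ((\<xi> j x)\<^sup>2 / 4)) \<partial>M)"
    unfolding split prod[symmetric] using noise_measurable(1)
    by (intro nn_integral_cmult borel_measurable_prod_ennreal) simp
  also have "\<dots> \<le> ennreal ((1 / 2) ^ l) * ennreal (3 / 2) ^ l"
  proof (intro mult_mono ennreal_leI)
    show "(\<Prod>j=1..l. \<integral>\<^sup>+x. ennreal (exp ((\<xi> j x)\<^sup>2 / 4)) \<partial>M) \<le> ennreal (3 / 2) ^ l"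
    proof (induction l)
      case (Suc l)
      then show ?case
        using mult_mono[OF Suc noise_exp_moment(1)[of "Suc l"]] by (simp add: mult.commute)
    qed simp
    have "(2::real) \<le> exp 1" using exp_ge_add_one_self[of 1] by simp
    then have "exp (- 1 :: real) \<le> 1 / 2" by (simp add: exp_minus field_simps)
    then have "exp (- 1 :: real) ^ l \<le> (1 / 2) ^ l" by (intro power_mono) auto
    then show "exp (- real l) \<le> (1 / 2) ^ l" by (simp flip: exp_of_nat_mult)
  qed auto
  also have "\<dots> = ennreal ((3 / 4) ^ l)"
    by (simp add: ennreal_power flip: ennreal_mult power_mult_distrib)
  finally show ?thesis .
qed

end

section \<open>One realisation of the observations\<close>

text \<open>
  The noise sequences \<open>xi\<close> and \<open>ze\<close> are fixed real sequences here: the bounds of this section hold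
  for every realisation and are integrated afterwards.
\<close>

locale observed_inverse_problem =
  fixes \<phi> :: "nat \<Rightarrow> 'h::real_inner" and f :: 'h
    and w \<gamma> lam a xi ze :: "nat \<Rightarrow> real" and d \<epsilon> \<sigma> r :: real
  assumes \<phi>: "orthonormal_seq \<phi>"
    and w_pos: "1 \<le> j \<Longrightarrow> 0 < w j" and w_one: "w 1 = 1"
    and \<gamma>_pos: "1 \<le> j \<Longrightarrow> 0 < \<gamma> j" and \<gamma>_one: "\<gamma> 1 = 1"
    and ratio_antimono: "\<lbrakk>1 \<le> i; i \<le> j\<rbrakk> \<Longrightarrow> w j / \<gamma> j \<le> w i / \<gamma> i"
    and lam_pos: "1 \<le> j \<Longrightarrow> 0 < lam j"
    and lam_antimono: "\<lbrakk>1 \<le> i; i \<le> j\<rbrakk> \<Longrightarrow> lam j \<le> lam i"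
    and d_ge_1: "1 \<le> d"
    and a_pos: "1 \<le> j \<Longrightarrow> 0 < a j"
    and a_bounds: "1 \<le> j \<Longrightarrow> lam j / d \<le> (a j)\<^sup>2" "1 \<le> j \<Longrightarrow> (a j)\<^sup>2 \<le> d * lam j"
    and \<epsilon>: "\<epsilon> \<in> {0<..<1}" and \<sigma>: "\<sigma> \<in> {0<..<1}"
    and r_nonneg: "0 \<le> r" and f_ellipsoid: "f \<in> ellipsoid \<phi> \<gamma> r"
begin

abbreviation F :: "nat \<Rightarrow> real" where
  "F \<equiv> coeff_of \<phi> f"

abbreviation X :: "nat \<Rightarrow> real" where
  "X \<equiv> \<lambda>j. a j + sqrt \<sigma> * ze j"

abbreviation Y :: "nat \<Rightarrow> real" where
  "Y \<equiv> \<lambda>j. a j * F j + sqrt \<epsilon> * xi j"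

abbreviation K :: nat where
  "K \<equiv> K_idx w \<epsilon> \<sigma> X"

abbreviation kh :: nat where
  "kh \<equiv> k_hat \<phi> w \<epsilon> \<sigma> Y X"

abbreviation n :: nat where
  "n \<equiv> nat \<lfloor>1 / \<sigma>\<rfloor>"

definition noise_part :: "nat \<Rightarrow> real" where
  "noise_part j = (if (X j)\<^sup>2 \<ge> \<sigma> then sqrt \<epsilon> * xi j / X j else 0)"

definition drift :: "nat \<Rightarrow> real" where
  "drift j = (if (X j)\<^sup>2 \<ge> \<sigma> then - (sqrt \<sigma> * ze j) / X j * F j else - F j)"

lemma \<epsilon>\<sigma>_bounds: "0 < \<epsilon>" "\<epsilon> < 1" "0 < \<sigma>" "\<sigma> < 1"
  using \<epsilon> \<sigma> by auto

lemma quotient_decomposition: "thresholded_quotient \<sigma> Y X j = F j + noise_part j + drift j"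
proof (cases "(X j)\<^sup>2 \<ge> \<sigma>")
  case True
  then have "X j \<noteq> 0" using \<epsilon>\<sigma>_bounds by auto
  then have "Y j / X j = F j + sqrt \<epsilon> * xi j / X j + - (sqrt \<sigma> * ze j) / X j * F j"
    by (simp add: divide_simps) (simp add: algebra_simps)
  then show ?thesis using True by (simp add: thresholded_quotient_def noise_part_def drift_def)
qed (simp add: thresholded_quotient_def noise_part_def drift_def)

lemma w_le_\<gamma>: "1 \<le> j \<Longrightarrow> w j \<le> \<gamma> j"
  using ratio_antimono[of 1 j] w_one \<gamma>_one \<gamma>_pos[of j] by simp

abbreviation energy :: "nat \<Rightarrow> real" where
  "energy j \<equiv> \<gamma> j * (F j)\<^sup>2"

lemma energy_nonneg: "1 \<le> j \<Longrightarrow> 0 \<le> energy j"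
  using \<gamma>_pos[of j] by simp

lemma ellipsoid_sum: "(\<Sum>j=1..m. energy j) \<le> r"
  using f_ellipsoid r_nonneg \<gamma>_pos by (intro wnorm_sq_leD) (auto simp: ellipsoid_def intro: less_imp_le)

lemma upsilon_upper: "1 \<le> j \<Longrightarrow> w j / \<gamma> j * min 1 (\<sigma> / lam j) \<le> upsilon w \<gamma> lam \<sigma>"
  unfolding upsilon_def
proof (rule cSUP_upper)
  show "bdd_above ((\<lambda>k. w k / \<gamma> k * min 1 (\<sigma> / lam k)) ` {1..})"
  proof (rule bdd_aboveI2)
    fix k :: nat assume "k \<in> {1..}"
    then have k: "1 \<le> k" by simp
    have "w k / \<gamma> k * min 1 (\<sigma> / lam k) \<le> 1 * 1"
      using w_le_\<gamma>[OF k] \<gamma>_pos[OF k] lam_pos[OF k] \<epsilon>\<sigma>_bounds by (intro mult_mono) auto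
    then show "w k / \<gamma> k * min 1 (\<sigma> / lam k) \<le> 1" by simp
  qed
qed simp

lemma upsilon_nonneg: "0 \<le> upsilon w \<gamma> lam \<sigma>"
proof -
  have "0 \<le> w 1 / \<gamma> 1 * min 1 (\<sigma> / lam 1)"
    using w_one \<gamma>_one lam_pos[of 1] \<epsilon>\<sigma>_bounds by simp
  then show ?thesis using upsilon_upper[of 1] by linarith
qed

lemma bias_le:
  assumes k: "1 \<le> k"
  shows "(\<Sum>j\<in>{k<..m}. w j * (F j)\<^sup>2) \<le> w k / \<gamma> k * r"
proof -
  have "w j * (F j)\<^sup>2 \<le> w k / \<gamma> k * energy j" if "j \<in> {k<..m}" for j
  proof -
    have "w j / \<gamma> j * energy j \<le> w k / \<gamma> k * energy j"
      using ratio_antimono[of k j] \<gamma>_pos[of j] that k by (intro mult_right_mono) auto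
    then show ?thesis using \<gamma>_pos[of j] that by simp
  qed
  then have "(\<Sum>j\<in>{k<..m}. w j * (F j)\<^sup>2) \<le> w k / \<gamma> k * (\<Sum>j\<in>{k<..m}. energy j)"
    unfolding sum_distrib_left by (rule sum_mono)
  also have "\<dots> \<le> w k / \<gamma> k * (\<Sum>j=1..m. energy j)"
    using w_pos[OF k] \<gamma>_pos[OF k] energy_nonneg by (intro mult_left_mono sum_mono2) auto
  also have "\<dots> \<le> w k / \<gamma> k * r"
    using ellipsoid_sum[of m] w_pos[OF k] \<gamma>_pos[OF k] by (intro mult_left_mono) auto
  finally show ?thesis .
qed

lemma K_ge_1: "1 \<le> K"
  by (rule K_idx_ge_1[where w = w, OF \<epsilon> \<sigma> w_one])

lemma K_le_n: "K \<le> n"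
  using K_idx_le_inverse_noise[where w = w and \<alpha> = X, OF \<epsilon> \<sigma> w_one] by (simp add: le_nat_floor)

lemma n_le: "real n \<le> 1 / \<sigma>"
  using \<epsilon>\<sigma>_bounds by simp

lemma k_hat_minimises_contrast:
  defines "V \<equiv> \<lambda>k. \<Sum>j=1..k. w j * (F j + noise_part j + drift j)\<^sup>2"
  shows "kh \<in> {1..K}" and "k \<in> {1..K} \<Longrightarrow> pen_hat w \<epsilon> X kh - V kh \<le> pen_hat w \<epsilon> X k - V k"
proof -
  have con: "con_hat \<phi> w \<epsilon> \<sigma> Y X k = Max ((\<lambda>j. V j - V k - pen_hat w \<epsilon> X j) ` {k..K})" for k
  proof -
    have "(\<lambda>j. enn2real (wnorm_sq \<phi> w (f_hat \<phi> \<sigma> Y X j - f_hat \<phi> \<sigma> Y X k)) - pen_hat w \<epsilon> X j) ` {k..K}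
        = (\<lambda>j. V j - V k - pen_hat w \<epsilon> X j) ` {k..K}"
      using w_pos unfolding V_def quotient_decomposition[symmetric]
      by (intro image_cong refl, subst wnorm_sq_f_hat_diff[OF \<phi>]) (auto intro: less_imp_le)
    then show ?thesis unfolding con_hat_def by simp
  qed
  note sel = comparison_selects_contrast_minimiser[OF K_ge_1 con k_hat_def]
  show "kh \<in> {1..K}" by (rule sel(1))
  show "pen_hat w \<epsilon> X kh - V kh \<le> pen_hat w \<epsilon> X k - V k" if "k \<in> {1..K}"
    by (rule sel(2)[OF that])
qed

lemma noise_part_le: "w j * (noise_part j)\<^sup>2 \<le> \<epsilon> * (w j / (X j)\<^sup>2 * (xi j)\<^sup>2)" if "1 \<le> j"
  using \<epsilon>\<sigma>_bounds w_pos[OF that] by (simp add: noise_part_def power_divide power_mult_distrib mult_ac)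

lemma noise_part_le_crude:
  assumes "j \<in> {1..K}"
  shows "w j * (noise_part j)\<^sup>2 \<le> (xi j)\<^sup>2 / \<sigma>"
proof (cases "(X j)\<^sup>2 \<ge> \<sigma>")
  case True
  have w: "w j \<le> 1 / \<epsilon>" "0 < w j"
    using weight_le_up_to_K_idx[where w = w and \<alpha> = X, OF \<epsilon> \<sigma> w_one assms] assms w_pos[of j] by auto
  have "w j * (noise_part j)\<^sup>2 \<le> \<epsilon> * (w j / (X j)\<^sup>2 * (xi j)\<^sup>2)"
    using assms by (intro noise_part_le) auto
  also have "\<dots> \<le> \<epsilon> * ((1 / \<epsilon>) / \<sigma> * (xi j)\<^sup>2)"
    using True w \<epsilon>\<sigma>_bounds by (intro mult_left_mono mult_right_mono frac_le) auto
  also have "\<dots> = (xi j)\<^sup>2 / \<sigma>" using \<epsilon>\<sigma>_bounds by simp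
  finally show ?thesis .
qed (use \<epsilon>\<sigma>_bounds in \<open>simp add: noise_part_def\<close>)

lemma drift_sq: "(X j)\<^sup>2 \<ge> \<sigma> \<Longrightarrow> (drift j)\<^sup>2 = (F j)\<^sup>2 * (ze j)\<^sup>2 * (\<sigma> / (X j)\<^sup>2)"
  "\<not> (X j)\<^sup>2 \<ge> \<sigma> \<Longrightarrow> (drift j)\<^sup>2 = (F j)\<^sup>2"
  using \<epsilon>\<sigma>_bounds by (simp_all add: drift_def power_divide power_mult_distrib)

lemma drift_le_crude: "(drift j)\<^sup>2 \<le> (F j)\<^sup>2 * (1 + (ze j)\<^sup>2)"
proof (cases "(X j)\<^sup>2 \<ge> \<sigma>")
  case True
  then have "\<sigma> / (X j)\<^sup>2 \<le> 1" using \<epsilon>\<sigma>_bounds by (subst divide_le_eq_1) auto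
  then have "(F j)\<^sup>2 * (ze j)\<^sup>2 * (\<sigma> / (X j)\<^sup>2) \<le> (F j)\<^sup>2 * (ze j)\<^sup>2 * 1"
    by (intro mult_left_mono) auto
  then have "(drift j)\<^sup>2 \<le> (F j)\<^sup>2 * (ze j)\<^sup>2" using drift_sq(1)[OF True] by simp
  also have "\<dots> \<le> (F j)\<^sup>2 * (1 + (ze j)\<^sup>2)" by (intro mult_left_mono) auto
  finally show ?thesis .
qed (simp add: drift_sq algebra_simps)

text \<open>
  If the threshold keeps coordinate \<open>j\<close>, then \<open>\<sigma> / (X j)\<^sup>2\<close> is at most 1, and at most
  \<open>4 * d * \<sigma> / lam j\<close>. If it removes the coordinate, then \<open>lam j\<close> is at most \<open>4 * d * \<sigma>\<close>, and the
  whole coefficient may be lost.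
\<close>

lemma drift_le:
  assumes j: "1 \<le> j" and X: "lam j / (4 * d) \<le> (X j)\<^sup>2"
  shows "(drift j)\<^sup>2 \<le> 4 * d * ((F j)\<^sup>2 * (1 + (ze j)\<^sup>2)) * min 1 (\<sigma> / lam j)"
proof (cases "(X j)\<^sup>2 \<ge> \<sigma>")
  case True
  have X_pos: "0 < (X j)\<^sup>2" using True \<epsilon>\<sigma>_bounds by linarith
  have "\<sigma> / (X j)\<^sup>2 \<le> 1" using True X_pos by simp
  moreover have "\<sigma> / (X j)\<^sup>2 \<le> \<sigma> / (lam j / (4 * d))"
    using X lam_pos[OF j] d_ge_1 \<epsilon>\<sigma>_bounds X_pos by (intro divide_left_mono) auto
  ultimately have "\<sigma> / (X j)\<^sup>2 \<le> 4 * d * min 1 (\<sigma> / lam j)"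
    using d_ge_1 by (auto simp: min_def mult_ac)
  then have "(F j)\<^sup>2 * (ze j)\<^sup>2 * (\<sigma> / (X j)\<^sup>2) \<le> (F j)\<^sup>2 * (ze j)\<^sup>2 * (4 * d * min 1 (\<sigma> / lam j))"
    by (intro mult_left_mono) auto
  also have "\<dots> \<le> (F j)\<^sup>2 * (1 + (ze j)\<^sup>2) * (4 * d * min 1 (\<sigma> / lam j))"
    using d_ge_1 lam_pos[OF j] \<epsilon>\<sigma>_bounds by (intro mult_right_mono mult_left_mono) auto
  finally show ?thesis using drift_sq(1)[OF True] by (simp add: mult_ac)
next
  case False
  then have "lam j / (4 * d) < \<sigma>" using X by linarith
  then have "1 \<le> 4 * d * (\<sigma> / lam j)" using d_ge_1 lam_pos[OF j] by (simp add: field_simps)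
  then have "1 \<le> 4 * d * min 1 (\<sigma> / lam j)" using d_ge_1 by (auto simp: min_def)
  then have "(F j)\<^sup>2 * (1 + (ze j)\<^sup>2) * 1 \<le> (F j)\<^sup>2 * (1 + (ze j)\<^sup>2) * (4 * d * min 1 (\<sigma> / lam j))"
    by (intro mult_left_mono) auto
  then have "(F j)\<^sup>2 * (1 + (ze j)\<^sup>2) \<le> 4 * d * ((F j)\<^sup>2 * (1 + (ze j)\<^sup>2)) * min 1 (\<sigma> / lam j)"
    by (simp add: mult_ac)
  then show ?thesis using drift_le_crude[of j] by linarith
qed

definition loss_upto :: "nat \<Rightarrow> real" where
  "loss_upto m = (\<Sum>j=1..m. w j * ((if j \<le> kh then F j + noise_part j + drift j else 0) - F j)\<^sup>2)"

lemma adaptive_loss_le: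
  assumes "\<And>m. K \<le> m \<Longrightarrow> loss_upto m \<le> c"
  shows "wnorm_sq \<phi> w (adaptive_est \<phi> w \<epsilon> \<sigma> Y X - f) \<le> ennreal c"
proof (rule wnorm_sq_leI)
  fix m assume "K \<le> m"
  have "(\<Sum>j=1..m. w j * (coeff_of \<phi> (adaptive_est \<phi> w \<epsilon> \<sigma> Y X - f) j)\<^sup>2) = loss_upto m"
    unfolding loss_upto_def
  proof (intro sum.cong refl)
    fix j assume "j \<in> {1..m}"
    then have "1 \<le> j" by simp
    from coeff_of_f_hat[OF \<phi> this, of \<sigma> Y X kh]
    show "w j * (coeff_of \<phi> (adaptive_est \<phi> w \<epsilon> \<sigma> Y X - f) j)\<^sup>2
        = w j * ((if j \<le> kh then F j + noise_part j + drift j else 0) - F j)\<^sup>2"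
      unfolding quotient_decomposition adaptive_est_def by (simp add: coeff_of_def inner_diff_left)
  qed
  then show "(\<Sum>j=1..m. w j * (coeff_of \<phi> (adaptive_est \<phi> w \<epsilon> \<sigma> Y X - f) j)\<^sup>2) \<le> c"
    using assms[OF \<open>K \<le> m\<close>] by simp
qed (use w_pos in \<open>auto intro: less_imp_le\<close>)


abbreviation M_plus :: nat where
  "M_plus \<equiv> M_idx \<sigma> (\<lambda>j. sqrt (4 * d * lam j))"

definition operator_well_observed :: bool where
  "operator_well_observed \<longleftrightarrow> (\<forall>j\<in>{1..Suc M_plus}. 2 * (sqrt \<sigma> * \<bar>ze j\<bar>) < a j)"

lemma X_bounds:
  assumes "operator_well_observed" and j: "j \<in> {1..Suc M_plus}"
  shows "lam j / (4 * d) \<le> (X j)\<^sup>2" "(X j)\<^sup>2 \<le> 4 * d * lam j"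
proof -
  have j1: "1 \<le> j" using j by simp
  have "2 * \<bar>sqrt \<sigma> * ze j\<bar> < a j"
    using assms \<epsilon>\<sigma>_bounds unfolding operator_well_observed_def by (simp add: abs_mult)
  then have "a j / 2 \<le> X j" "X j \<le> 2 * a j" using a_pos[OF j1] by linarith+
  then have "(a j / 2)\<^sup>2 \<le> (X j)\<^sup>2" "(X j)\<^sup>2 \<le> (2 * a j)\<^sup>2"
    using a_pos[OF j1] by (intro power_mono; simp)+
  then show "lam j / (4 * d) \<le> (X j)\<^sup>2" "(X j)\<^sup>2 \<le> 4 * d * lam j"
    using a_bounds[OF j1] by (simp_all add: power2_eq_square)
qed

lemma K_sandwich:
  assumes "operator_well_observed"
  shows "K_idx w \<epsilon> \<sigma> (\<lambda>j. sqrt (lam j / (4 * d))) \<le> K" and "K \<le> M_plus"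
proof -
  let ?\<alpha> = "\<lambda>j. sqrt (lam j / (4 * d))" and ?\<beta> = "\<lambda>j. sqrt (4 * d * lam j)"
  have sq: "(?\<alpha> j)\<^sup>2 = lam j / (4 * d)" "(?\<beta> j)\<^sup>2 = 4 * d * lam j" if "1 \<le> j" for j
    using lam_pos[OF that] d_ge_1 by simp_all
  have "lam j / (4 * d) \<le> 4 * d * lam j" if "1 \<le> j" for j
  proof -
    have "lam j / (4 * d) \<le> lam j / 1"
      using lam_pos[OF that] d_ge_1 by (intro divide_left_mono) auto
    also have "\<dots> \<le> 4 * d * lam j" using lam_pos[OF that] d_ge_1 by simp
    finally show ?thesis .
  qed
  then have mono: "(?\<alpha> j)\<^sup>2 \<le> (?\<beta> j)\<^sup>2" if "1 \<le> j" for j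
    using sq[OF that] that by simp
  have X: "(?\<alpha> j)\<^sup>2 \<le> (X j)\<^sup>2 \<and> (X j)\<^sup>2 \<le> (?\<beta> j)\<^sup>2" if "j \<in> {1..Suc M_plus}" for j
    using X_bounds[OF assms that] sq[of j] that by simp
  note K_idx_sandwich[where w = w and X = X and \<alpha> = ?\<alpha> and \<beta> = ?\<beta>, OF \<epsilon> \<sigma> w_one w_pos X mono]
  then show "K_idx w \<epsilon> \<sigma> ?\<alpha> \<le> K" "K \<le> M_plus" by blast+
qed

definition exp_energy :: real where
  "exp_energy = (\<Sum>l=1..n. exp ((\<Sum>j=1..l. (xi j)\<^sup>2) / 4 - real l))"

lemma one_plus_sq_le: "1 + t\<^sup>2 \<le> 4 * exp (t\<^sup>2 / 4)" for t :: real
  using exp_ge_add_one_self[of "t\<^sup>2 / 4"] by linarith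

lemma loss_well_observed:
  assumes good: "operator_well_observed"
    and k: "k \<in> {1..K_idx w \<epsilon> \<sigma> (\<lambda>j. sqrt (lam j / (4 * d)))}" and m: "K \<le> m"
  shows "loss_upto m \<le> 7200 * d * (1 + ln (4 * d)) * (delta w (\<lambda>j. sqrt (lam j)) k * \<epsilon>)
    + 16 * \<epsilon> * exp_energy
    + 64 * d * upsilon w \<gamma> lam \<sigma> * (\<Sum>j=1..n. energy j * exp ((ze j)\<^sup>2 / 4))
    + 3 * r * (w k / \<gamma> k)"
proof -
  let ?p = "pen_hat w \<epsilon> X" and ?\<upsilon> = "upsilon w \<gamma> lam \<sigma>"
  let ?Z = "\<Sum>j=1..n. energy j * exp ((ze j)\<^sup>2 / 4)"
  have w0: "0 \<le> w j" if "1 \<le> j" for j using w_pos[OF that] by simp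
  have kK: "k \<in> {1..K}" using k K_sandwich(1)[OF good] by auto
  have lam_le_X: "lam j / (4 * d) \<le> (X j)\<^sup>2" if "j \<in> {1..K}" for j
    using X_bounds(1)[OF good, of j] K_sandwich(2)[OF good] that by auto
  have p_nonneg: "0 \<le> ?p l" if "l \<in> {1..K}" for l
    using delta_nonneg[of l w X] that w0 \<epsilon>\<sigma>_bounds by (simp add: pen_hat_def)
  have pen: "delta w X k \<le> 4 * d * (1 + ln (4 * d)) * delta w (\<lambda>j. sqrt (lam j)) k"
  proof (rule delta_le_mult)
    fix j assume "j \<in> {1..k}"
    then show "0 < (sqrt (lam j))\<^sup>2 \<and> (sqrt (lam j))\<^sup>2 \<le> 4 * d * (X j)\<^sup>2"
      using lam_pos[of j] lam_le_X[of j] kK d_ge_1 by (simp add: field_simps)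
  qed (use kK w0 d_ge_1 in auto)
  have "1800 * delta w X k * \<epsilon> \<le> 1800 * (4 * d * (1 + ln (4 * d)) * delta w (\<lambda>j. sqrt (lam j)) k) * \<epsilon>"
    using \<epsilon>\<sigma>_bounds by (intro mult_right_mono[OF mult_left_mono[OF pen]]) auto
  then have p_le: "3 * ?p k \<le> 7200 * d * (1 + ln (4 * d)) * (delta w (\<lambda>j. sqrt (lam j)) k * \<epsilon>)"
    by (simp add: pen_hat_def mult_ac)
  \<comment> \<open>A sixth of the factor 600 in the penalty is the factor 100 that the noise bound asks for.\<close>
  have noise: "(\<Sum>j=1..l. w j * (noise_part j)\<^sup>2) \<le> ?p l / 6 + 4 * \<epsilon> * exp_energy" if l: "l \<in> {1..K}" for l
  proof -
    have "(\<Sum>j=1..l. w j * (noise_part j)\<^sup>2) \<le> \<epsilon> * (\<Sum>j=1..l. w j / (X j)\<^sup>2 * (xi j)\<^sup>2)"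
      unfolding sum_distrib_left by (intro sum_mono noise_part_le) auto
    also have "\<dots> \<le> \<epsilon> * (100 * delta w X l + 4 * exp ((\<Sum>j=1..l. (xi j)\<^sup>2) / 4 - real l))"
      using l w0 \<epsilon>\<sigma>_bounds by (intro mult_left_mono noise_le_penalty_plus_exp) auto
    also have "exp ((\<Sum>j=1..l. (xi j)\<^sup>2) / 4 - real l) \<le> exp_energy"
      unfolding exp_energy_def using l K_le_n by (intro member_le_sum) auto
    finally show ?thesis using \<epsilon>\<sigma>_bounds by (simp add: pen_hat_def algebra_simps)
  qed
  have drift: "(\<Sum>j=1..K. w j * (drift j)\<^sup>2) \<le> 16 * d * ?\<upsilon> * ?Z"
  proof -
    have "w j * (drift j)\<^sup>2 \<le> 16 * d * ?\<upsilon> * (energy j * exp ((ze j)\<^sup>2 / 4))" if j: "j \<in> {1..K}" for j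
    proof -
      have j1: "1 \<le> j" using j by simp
      have "w j * (drift j)\<^sup>2 \<le> w j * (4 * d * ((F j)\<^sup>2 * (1 + (ze j)\<^sup>2)) * min 1 (\<sigma> / lam j))"
        using w0[OF j1] drift_le[OF j1 lam_le_X[OF j]] by (intro mult_left_mono)
      also have "\<dots> = 4 * d * (w j / \<gamma> j * min 1 (\<sigma> / lam j)) * (energy j * (1 + (ze j)\<^sup>2))"
        using \<gamma>_pos[OF j1] by (simp add: field_simps)
      also have "\<dots> \<le> 4 * d * ?\<upsilon> * (energy j * (4 * exp ((ze j)\<^sup>2 / 4)))"
        using upsilon_upper[OF j1] upsilon_nonneg d_ge_1 one_plus_sq_le[of "ze j"] w0[OF j1] \<gamma>_pos[OF j1]
          lam_pos[OF j1] \<epsilon>\<sigma>_bounds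
        by (intro mult_mono mult_nonneg_nonneg) auto
      finally show ?thesis by (simp add: mult_ac)
    qed
    then have "(\<Sum>j=1..K. w j * (drift j)\<^sup>2) \<le> 16 * d * ?\<upsilon> * (\<Sum>j=1..K. energy j * exp ((ze j)\<^sup>2 / 4))"
      unfolding sum_distrib_left by (rule sum_mono)
    also have "\<dots> \<le> 16 * d * ?\<upsilon> * ?Z"
      using K_le_n d_ge_1 upsilon_nonneg energy_nonneg by (intro mult_left_mono sum_mono2) auto
    finally show ?thesis .
  qed
  have R: "0 \<le> 4 * \<epsilon> * exp_energy"
    unfolding exp_energy_def using \<epsilon>\<sigma>_bounds by (intro mult_nonneg_nonneg sum_nonneg) auto
  have "loss_upto m \<le> 3 * ?p k + 4 * (4 * \<epsilon> * exp_energy) + 4 * (16 * d * ?\<upsilon> * ?Z) + 3 * (w k / \<gamma> k * r)"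
    unfolding loss_upto_def
  proof (rule oracle_inequality[where K = K])
    show "?p kh - (\<Sum>j = 1..kh. w j * (F j + noise_part j + drift j)\<^sup>2)
        \<le> ?p k - (\<Sum>j = 1..k. w j * (F j + noise_part j + drift j)\<^sup>2)"
      by (rule k_hat_minimises_contrast(2)[OF kK])
  qed (use w0 k_hat_minimises_contrast(1) kK p_nonneg noise R drift bias_le m in auto)
  then show ?thesis using p_le by (simp add: mult_ac)
qed

text \<open>
  The threshold and the bound \<open>w j \<le> 1 / \<epsilon>\<close>, which holds up to \<open>K\<close>, keep the loss polynomial in
  \<open>1 / \<sigma>\<close> in all cases.
\<close>

lemma loss_crude:
  assumes m: "K \<le> m"
  shows "loss_upto m \<le> (\<Sum>j=1..n. 2 / \<sigma> * (xi j)\<^sup>2) + (\<Sum>j=1..n. 2 * energy j * (1 + (ze j)\<^sup>2)) + r"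
proof -
  have kh: "kh \<in> {1..K}" by (rule k_hat_minimises_contrast(1))
  let ?b = "\<lambda>j. 2 / \<sigma> * (xi j)\<^sup>2 + 2 * energy j * (1 + (ze j)\<^sup>2)"
  have term_le: "w j * ((if j \<le> kh then F j + noise_part j + drift j else 0) - F j)\<^sup>2
      \<le> (if j \<le> kh then ?b j else 0) + energy j" if j: "j \<in> {1..m}" for j
  proof (cases "j \<le> kh")
    case True
    have j1: "1 \<le> j" and jK: "j \<in> {1..K}" using j True kh by auto
    have "(noise_part j + drift j)\<^sup>2 \<le> 2 * (noise_part j)\<^sup>2 + 2 * (drift j)\<^sup>2"
      using zero_le_power2[of "noise_part j - drift j"] by (simp add: power2_eq_square algebra_simps)
    from mult_left_mono[OF this less_imp_le[OF w_pos[OF j1]]]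
    have "w j * (noise_part j + drift j)\<^sup>2 \<le> 2 * (w j * (noise_part j)\<^sup>2) + 2 * (w j * (drift j)\<^sup>2)"
      by (simp add: algebra_simps)
    also have "w j * (drift j)\<^sup>2 \<le> \<gamma> j * ((F j)\<^sup>2 * (1 + (ze j)\<^sup>2))"
      using drift_le_crude[of j] w_le_\<gamma>[OF j1] \<gamma>_pos[OF j1] by (intro mult_mono) auto
    also have "w j * (noise_part j)\<^sup>2 \<le> (xi j)\<^sup>2 / \<sigma>" by (rule noise_part_le_crude[OF jK])
    finally show ?thesis using True energy_nonneg[OF j1] by (simp add: mult_ac add.assoc)
  next
    case False
    then show ?thesis using w_le_\<gamma>[of j] j by (auto intro: mult_right_mono)
  qed
  have "loss_upto m \<le> (\<Sum>j=1..m. if j \<le> kh then ?b j else 0) + (\<Sum>j=1..m. energy j)"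
    unfolding loss_upto_def sum.distrib[symmetric] by (intro sum_mono term_le)
  also have "(\<Sum>j=1..m. if j \<le> kh then ?b j else 0) = (\<Sum>j=1..kh. ?b j)"
    using kh m by (intro sum.mono_neutral_cong_right) auto
  also have "\<dots> \<le> (\<Sum>j=1..n. ?b j)"
    using kh K_le_n \<epsilon>\<sigma>_bounds \<gamma>_pos by (intro sum_mono2 add_nonneg_nonneg mult_nonneg_nonneg) (auto intro: less_imp_le)
  also have "(\<Sum>j=1..m. energy j) \<le> r" by (rule ellipsoid_sum)
  finally show ?thesis by (simp add: sum.distrib)
qed

text \<open>
  An exponential Markov bound, kept as a function: \<open>failure\<close> is at least 1 as soon as the
  error of one \<open>X j\<close> reaches half the singular value, and its expectation is of order \<open>\<sigma> ^ 6\<close> by the tail hypothesis on \<open>lam\<close>.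
\<close>

definition failure :: real where
  "failure = exp (- (lam (Suc M_plus) / (72 * \<sigma> * d))) * (\<Sum>j=1..Suc M_plus. exp ((ze j)\<^sup>2 / 4))"

lemma failure_nonneg: "0 \<le> failure"
  unfolding failure_def by (intro mult_nonneg_nonneg sum_nonneg) auto

lemma failure_ge_1:
  assumes "\<not> operator_well_observed"
  shows "1 \<le> failure"
proof -
  let ?l = "lam (Suc M_plus)"
  obtain j where j: "j \<in> {1..Suc M_plus}" and far: "a j \<le> 2 * (sqrt \<sigma> * \<bar>ze j\<bar>)"
    using assms unfolding operator_well_observed_def by (auto simp: not_less)
  have "?l / d \<le> lam j / d"
    using j lam_antimono[of j "Suc M_plus"] d_ge_1 by (intro divide_right_mono) auto
  also have "\<dots> \<le> (a j)\<^sup>2" using j by (intro a_bounds) auto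
  also have "\<dots> \<le> (2 * (sqrt \<sigma> * \<bar>ze j\<bar>))\<^sup>2"
    using far a_pos[of j] j by (intro power_mono) auto
  also have "\<dots> = 4 * \<sigma> * (ze j)\<^sup>2"
    using \<epsilon>\<sigma>_bounds by (simp add: power_mult_distrib)
  finally have "?l / d / (16 * \<sigma>) \<le> 4 * \<sigma> * (ze j)\<^sup>2 / (16 * \<sigma>)"
    using \<epsilon>\<sigma>_bounds by (intro divide_right_mono) auto
  then have "?l / d / (16 * \<sigma>) \<le> (ze j)\<^sup>2 / 4"
    using \<epsilon>\<sigma>_bounds by simp
  moreover have "?l / (72 * \<sigma> * d) \<le> ?l / d / (16 * \<sigma>)"
    using lam_pos[of "Suc M_plus"] d_ge_1 \<epsilon>\<sigma>_bounds by (simp add: field_simps)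
  ultimately have "0 \<le> - (?l / (72 * \<sigma> * d)) + (ze j)\<^sup>2 / 4" by linarith
  then have "exp 0 \<le> exp (- (?l / (72 * \<sigma> * d)) + (ze j)\<^sup>2 / 4)" by (subst exp_le_cancel_iff)
  then have "1 \<le> exp (- (?l / (72 * \<sigma> * d))) * exp ((ze j)\<^sup>2 / 4)"
    unfolding exp_zero exp_add .
  also have "\<dots> \<le> failure"
    unfolding failure_def using j by (intro mult_left_mono member_le_sum) auto
  finally show ?thesis .
qed

text \<open>
  On failure, a Young inequality with weight \<open>\<sigma> ^ 3\<close> separates \<open>failure\<close> from the other noise
  variables, so that each is integrated alone; the weight balances \<open>\<sigma> ^ 6 / \<sigma> ^ 3\<close>, coming from the
  mean of \<open>failure\<close>, against \<open>\<sigma> ^ 3\<close>.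
\<close>

lemma failure_young:
  assumes W: "1 \<le> W" and t: "0 \<le> t" "t \<le> 1 + x\<^sup>2"
  shows "2 * t \<le> W / \<sigma> ^ 3 + 32 * \<sigma> ^ 3 * exp (x\<^sup>2 / 4)"
proof -
  have "1 + x\<^sup>2 / 4 + (x\<^sup>2 / 4)\<^sup>2 / 2 \<le> exp (x\<^sup>2 / 4)"
    by (rule exp_lower_Taylor_quadratic) simp
  then have taylor: "32 * (1 + x\<^sup>2 / 4 + (x\<^sup>2 / 4)\<^sup>2 / 2) \<le> 32 * exp (x\<^sup>2 / 4)" by simp
  have "t\<^sup>2 \<le> (1 + x\<^sup>2)\<^sup>2" using t by (intro power_mono)
  also have "\<dots> \<le> 32 * (1 + x\<^sup>2 / 4 + (x\<^sup>2 / 4)\<^sup>2 / 2)"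
    by (simp add: power2_eq_square algebra_simps)
  also note taylor
  finally have "\<sigma> ^ 3 * t\<^sup>2 \<le> \<sigma> ^ 3 * (32 * exp (x\<^sup>2 / 4))"
    using \<epsilon>\<sigma>_bounds by (intro mult_left_mono) auto
  moreover have "2 * t \<le> 1 / \<sigma> ^ 3 + \<sigma> ^ 3 * t\<^sup>2"
  proof -
    have "0 \<le> (1 - \<sigma> ^ 3 * t)\<^sup>2 / \<sigma> ^ 3" using \<epsilon>\<sigma>_bounds by simp
    then show ?thesis using \<epsilon>\<sigma>_bounds by (simp add: power2_eq_square field_simps)
  qed
  moreover have "1 / \<sigma> ^ 3 \<le> W / \<sigma> ^ 3" using W \<epsilon>\<sigma>_bounds by (intro divide_right_mono) auto
  ultimately show ?thesis by linarith
qed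

lemma adaptive_loss_envelope:
  assumes k: "k \<in> {1..K_idx w \<epsilon> \<sigma> (\<lambda>j. sqrt (lam j / (4 * d)))}"
  shows "wnorm_sq \<phi> w (adaptive_est \<phi> w \<epsilon> \<sigma> Y X - f) \<le> ennreal
    (7200 * d * (1 + ln (4 * d)) * (delta w (\<lambda>j. sqrt (lam j)) k * \<epsilon>)
    + 16 * \<epsilon> * exp_energy
    + 64 * d * upsilon w \<gamma> lam \<sigma> * (\<Sum>j=1..n. energy j * exp ((ze j)\<^sup>2 / 4))
    + 3 * r * (w k / \<gamma> k)
    + ((\<Sum>j=1..n. 1 / \<sigma> * (1 / \<sigma> ^ 3 * failure + 32 * \<sigma> ^ 3 * exp ((xi j)\<^sup>2 / 4)))
      + (\<Sum>j=1..n. energy j * (1 / \<sigma> ^ 3 * failure + 32 * \<sigma> ^ 3 * exp ((ze j)\<^sup>2 / 4)))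
      + r * failure))"
  (is "_ \<le> ennreal (?G1 + ?G2 + ?G3 + ?G4 + (?H1 + ?H2 + r * failure))")
proof (rule adaptive_loss_le)
  fix m assume m: "K \<le> m"
  have k1: "1 \<le> k" using k by simp
  have "0 \<le> 1 / \<sigma> ^ 3 * failure + 32 * \<sigma> ^ 3 * exp t" for t :: real
    using failure_nonneg \<epsilon>\<sigma>_bounds by simp
  then have H: "0 \<le> ?H1" "0 \<le> ?H2" "0 \<le> r * failure"
    using failure_nonneg \<epsilon>\<sigma>_bounds r_nonneg
    by (intro sum_nonneg mult_nonneg_nonneg energy_nonneg; simp)+
  have "0 \<le> delta w (\<lambda>j. sqrt (lam j)) k"
    using w_pos k1 by (intro delta_nonneg) (auto intro: less_imp_le)
  moreover have "0 \<le> ln (4 * d)" using d_ge_1 by simp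
  moreover have "0 \<le> exp_energy" unfolding exp_energy_def by (intro sum_nonneg) auto
  moreover have "0 \<le> (\<Sum>j=1..n. energy j * exp ((ze j)\<^sup>2 / 4))"
    by (intro sum_nonneg mult_nonneg_nonneg[OF energy_nonneg]) auto
  moreover have "0 \<le> w k / \<gamma> k" using w_pos[OF k1] \<gamma>_pos[OF k1] by simp
  ultimately have G: "0 \<le> ?G1" "0 \<le> ?G2" "0 \<le> ?G3" "0 \<le> ?G4"
    using \<epsilon>\<sigma>_bounds d_ge_1 upsilon_nonneg r_nonneg
    by (intro mult_nonneg_nonneg; linarith | simp)+
  show "loss_upto m \<le> ?G1 + ?G2 + ?G3 + ?G4 + (?H1 + ?H2 + r * failure)"
  proof (cases operator_well_observed)
    case True
    show ?thesis using loss_well_observed[OF True k m] H by linarith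
  next
    case False
    note W = failure_ge_1[OF False]
    have "(\<Sum>j=1..n. 2 / \<sigma> * (xi j)\<^sup>2) \<le> ?H1"
    proof (rule sum_mono)
      fix j
      have "1 / \<sigma> * (2 * (xi j)\<^sup>2) \<le> 1 / \<sigma> * (failure / \<sigma> ^ 3 + 32 * \<sigma> ^ 3 * exp ((xi j)\<^sup>2 / 4))"
        using \<epsilon>\<sigma>_bounds by (intro mult_left_mono failure_young[OF W]) auto
      then show "2 / \<sigma> * (xi j)\<^sup>2 \<le> 1 / \<sigma> * (1 / \<sigma> ^ 3 * failure + 32 * \<sigma> ^ 3 * exp ((xi j)\<^sup>2 / 4))"
        by simp
    qed
    moreover have "(\<Sum>j=1..n. 2 * energy j * (1 + (ze j)\<^sup>2)) \<le> ?H2"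
    proof (rule sum_mono)
      fix j assume "j \<in> {1..n}"
      then have "energy j * (2 * (1 + (ze j)\<^sup>2)) \<le> energy j * (failure / \<sigma> ^ 3 + 32 * \<sigma> ^ 3 * exp ((ze j)\<^sup>2 / 4))"
        using energy_nonneg by (intro mult_left_mono failure_young[OF W]) auto
      then show "2 * energy j * (1 + (ze j)\<^sup>2) \<le> energy j * (1 / \<sigma> ^ 3 * failure + 32 * \<sigma> ^ 3 * exp ((ze j)\<^sup>2 / 4))"
        by (simp add: algebra_simps)
    qed
    moreover have "r \<le> r * failure" using mult_left_mono[OF W r_nonneg] by simp
    ultimately show ?thesis using loss_crude[OF m] G by linarith
  qed
qed

end

section \<open>Integration\<close>

text \<open>
  An upper bound for the mean that passes through nonnegative linear combinations without
  separate treatment of measurability and finiteness.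
\<close>

definition mean_le :: "'s measure \<Rightarrow> ('s \<Rightarrow> real) \<Rightarrow> real \<Rightarrow> bool" where
  "mean_le M g c \<longleftrightarrow> g \<in> borel_measurable M \<and> (\<forall>x. 0 \<le> g x) \<and> 0 \<le> c \<and>
     (\<integral>\<^sup>+x. ennreal (g x) \<partial>M) \<le> ennreal c"

lemma mean_le_const:
  assumes "prob_space M" "0 \<le> c"
  shows "mean_le M (\<lambda>_. c) c"
  using assms prob_space.emeasure_space_1[OF assms(1)] by (simp add: mean_le_def)

lemma mean_le_add:
  assumes "mean_le M g c" "mean_le M g' c'"
  shows "mean_le M (\<lambda>x. g x + g' x) (c + c')"
proof -
  have "(\<integral>\<^sup>+x. ennreal (g x + g' x) \<partial>M) = (\<integral>\<^sup>+x. ennreal (g x) \<partial>M) + (\<integral>\<^sup>+x. ennreal (g' x) \<partial>M)"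
    using assms unfolding mean_le_def by (subst nn_integral_add[symmetric]) auto
  also have "\<dots> \<le> ennreal c + ennreal c'"
    using assms unfolding mean_le_def by (intro add_mono) auto
  finally show ?thesis using assms unfolding mean_le_def by auto
qed

lemma mean_le_cmult:
  assumes "0 \<le> a" "mean_le M g c"
  shows "mean_le M (\<lambda>x. a * g x) (a * c)"
proof -
  have "(\<integral>\<^sup>+x. ennreal (a * g x) \<partial>M) = ennreal a * (\<integral>\<^sup>+x. ennreal (g x) \<partial>M)"
    using assms unfolding mean_le_def by (subst nn_integral_cmult[symmetric]) (auto simp: ennreal_mult)
  also have "\<dots> \<le> ennreal a * ennreal c"
    using assms unfolding mean_le_def by (intro mult_left_mono) auto
  finally show ?thesis using assms unfolding mean_le_def by (auto simp: ennreal_mult)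
qed

lemma mean_le_sum:
  assumes "prob_space M" "finite I" "\<And>i. i \<in> I \<Longrightarrow> mean_le M (g i) (c i)"
  shows "mean_le M (\<lambda>x. \<Sum>i\<in>I. g i x) (\<Sum>i\<in>I. c i)"
  using assms(2,3)
proof (induction I rule: finite_induct)
  case empty
  then show ?case using mean_le_const[OF assms(1), of 0] by simp
next
  case (insert i I)
  then show ?case using mean_le_add[of M "g i" "c i" "\<lambda>x. \<Sum>i\<in>I. g i x" "\<Sum>i\<in>I. c i"] by simp
qed

lemma sum_three_quarters_power_le: "(\<Sum>l=1..n. (3 / 4 :: real) ^ l) \<le> 3"
proof -
  have "(\<Sum>l=1..n. (3 / 4 :: real) ^ l) = 3 - 3 * (3 / 4) ^ n"
    by (induction n) (simp_all add: algebra_simps)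
  then show ?thesis by simp
qed

context
  fixes M :: "'s measure" and \<xi> \<zeta> :: "nat \<Rightarrow> 's \<Rightarrow> real"
  assumes noise: "std_normal_noise M \<xi> \<zeta>"
begin

lemma noise_prob_space: "prob_space M"
  using noise unfolding std_normal_noise_def by (rule conjunct1)

lemma mean_le_exp_noise:
  assumes "1 \<le> j"
  shows "mean_le M (\<lambda>x. exp ((\<xi> j x)\<^sup>2 / 4)) (3 / 2)"
    and "mean_le M (\<lambda>x. exp ((\<zeta> j x)\<^sup>2 / 4)) (3 / 2)"
  using noise_measurable[OF noise assms] noise_exp_moment[OF noise assms]
  by (simp_all add: mean_le_def)

lemma mean_le_exp_noise_energy:
  "mean_le M (\<lambda>x. exp ((\<Sum>j=1..l. (\<xi> j x)\<^sup>2) / 4 - real l)) ((3 / 4) ^ l)"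
proof -
  have "(\<lambda>x. \<Sum>j=1..l. (\<xi> j x)\<^sup>2) \<in> borel_measurable M"
    using noise_measurable(1)[OF noise] by (intro borel_measurable_sum borel_measurable_power) auto
  then show ?thesis
    unfolding mean_le_def using noise_energy_exp_moment[OF noise, of l] by simp
qed

end

lemma failure_mean_le:
  assumes \<sigma>: "\<sigma> \<in> {0<..<1}" and l: "0 < l" "l \<le> 1"
    and tail: "\<sigma> powr (-7) * l powr (-1/2) * exp (- (l / (72 * \<sigma> * d))) \<le> L"
  shows "exp (- (l / (72 * \<sigma> * d))) * (\<Sum>j=1..Suc (M_idx \<sigma> \<beta>). 3 / 2) \<le> 3 * L * \<sigma> ^ 6"
proof -
  let ?q = "exp (- (l / (72 * \<sigma> * d)))" and ?m = "real (Suc (M_idx \<sigma> \<beta>))"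
  have \<sigma>0: "0 < \<sigma>" "\<sigma> < 1" using \<sigma> by auto
  have "1 \<le> l powr (-1/2)"
    using powr_mono2'[of "-1/2" l 1] l by simp
  then have "\<sigma> powr (-7) * 1 * ?q \<le> \<sigma> powr (-7) * l powr (-1/2) * ?q"
    by (intro mult_right_mono mult_left_mono) auto
  then have "\<sigma> powr (-7) * ?q \<le> L" using tail by simp
  moreover have "\<sigma> powr (-7) = 1 / \<sigma> ^ 7"
    using \<sigma>0 by (simp add: powr_minus_divide)
  ultimately have q: "?q \<le> L * \<sigma> ^ 7" using \<sigma>0 by (simp add: divide_le_eq)
  have "real (M_idx \<sigma> \<beta>) \<le> 1 / \<sigma>"
    using le_M_idx_iff[OF \<sigma>0(1) M_idx_ge_1[OF \<sigma>], of \<beta> \<beta>] by simp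
  moreover have "1 \<le> 1 / \<sigma>" using \<sigma>0 by simp
  ultimately have m: "?m \<le> 2 / \<sigma>" by simp
  have "0 < ?q" by simp
  then have Lpos: "0 \<le> L * \<sigma> ^ 7" using q by linarith
  have "?q * ?m \<le> L * \<sigma> ^ 7 * (2 / \<sigma>)"
    using q m Lpos by (intro mult_mono) auto
  also have "\<dots> = 2 * L * \<sigma> ^ 6" using \<sigma>0 by (simp add: power_Suc eval_nat_numeral)
  finally have "?q * ?m * (3 / 2) \<le> 2 * L * \<sigma> ^ 6 * (3 / 2)" by (rule mult_right_mono) simp
  moreover have "?q * (\<Sum>j=1..Suc (M_idx \<sigma> \<beta>). 3 / 2) = ?q * ?m * (3 / 2)"
    by (simp only: sum_constant card_atLeastAtMost mult.assoc) simp
  ultimately show ?thesis by linarith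
qed

theorem theorem3p6:
  fixes lam :: "nat \<Rightarrow> real" and d :: real
  assumes lam_pos: "\<forall>j\<ge>1. lam j > 0"
    and lam_one: "lam 1 = 1"
    and lam_dec: "antimono_on {1..} lam"
    and lam_lim: "lam \<longlonglongrightarrow> 0"
    and d_ge: "d \<ge> 1"
    and tail: "\<exists>L>0. \<forall>\<sigma>\<in>{0<..<1}.
      (let m = M_idx \<sigma> (\<lambda>j. sqrt (4 * d * lam j)) + 1
       in \<sigma> powr (-7) * lam m powr (-1/2) * exp (- (lam m / (72 * \<sigma> * d))) \<le> L)"
  shows "\<exists>C>0.
    \<forall>(\<phi> :: nat \<Rightarrow> 'h::{real_inner,polish_space}) (\<psi> :: nat \<Rightarrow> 'g::{real_inner,polish_space})
     (M :: 's measure) \<xi> \<zeta> (\<omega> :: nat \<Rightarrow> real) (\<gamma> :: nat \<Rightarrow> real) r.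
      orthonormal_basis \<phi> \<longrightarrow> orthonormal_seq \<psi> \<longrightarrow> std_normal_noise M \<xi> \<zeta> \<longrightarrow>
      (\<forall>j\<ge>1. \<omega> j > 0 \<and> \<gamma> j > 0) \<longrightarrow> \<omega> 1 = 1 \<longrightarrow> \<gamma> 1 = 1 \<longrightarrow>
      antimono_on {1..} (\<lambda>j. \<omega> j / \<gamma> j) \<longrightarrow> r > 0 \<longrightarrow>
      (\<forall>\<epsilon>\<in>{0<..<1}. \<forall>\<sigma>\<in>{0<..<1}.
        (SUP f\<in>ellipsoid \<phi> \<gamma> r. SUP T\<in>operator_class \<phi> \<psi> lam d. risk \<phi> \<psi> M \<xi> \<zeta> \<omega> \<epsilon> \<sigma> f T)
        \<le> ennreal (C * (1 + r) *
            (Min ((\<lambda>k. max (\<omega> k / \<gamma> k) (delta \<omega> (\<lambda>j. sqrt (lam j)) k * \<epsilon>))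
                  ` {1..K_idx \<omega> \<epsilon> \<sigma> (\<lambda>j. sqrt (lam j / (4 * d)))})
             + upsilon \<omega> \<gamma> lam \<sigma> + \<epsilon> + \<sigma>)))"
proof -
  obtain L where L: "0 < L" and tail_L: "\<And>\<sigma>. \<sigma> \<in> {0<..<1} \<Longrightarrow>
      \<sigma> powr (-7) * lam (Suc (M_idx \<sigma> (\<lambda>j. sqrt (4 * d * lam j)))) powr (-1/2)
        * exp (- (lam (Suc (M_idx \<sigma> (\<lambda>j. sqrt (4 * d * lam j)))) / (72 * \<sigma> * d))) \<le> L"
    using tail unfolding Let_def by auto
  define C\<^sub>1 where "C\<^sub>1 = 7200 * d * (1 + ln (4 * d))"
  define C where "C = C\<^sub>1 + 96 * d + 6 * L + 96"
  have C\<^sub>1: "0 \<le> C\<^sub>1" unfolding C\<^sub>1_def using d_ge by simp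
  have C: "0 < C" "C\<^sub>1 \<le> C" "48 + 3 * L \<le> C" "48 + 6 * L \<le> C" "96 * d \<le> C" "3 \<le> C" "48 \<le> C"
    unfolding C_def using C\<^sub>1 d_ge L by auto
  have bound: "risk \<phi> \<psi> M \<xi> \<zeta> \<omega> \<epsilon> \<sigma> f T \<le> ennreal (C * (1 + r) *
      (Min ((\<lambda>k. max (\<omega> k / \<gamma> k) (delta \<omega> (\<lambda>j. sqrt (lam j)) k * \<epsilon>))
            ` {1..K_idx \<omega> \<epsilon> \<sigma> (\<lambda>j. sqrt (lam j / (4 * d)))})
       + upsilon \<omega> \<gamma> lam \<sigma> + \<epsilon> + \<sigma>))"
    if \<phi>: "orthonormal_basis \<phi>" and \<psi>: "orthonormal_seq \<psi>" and noise: "std_normal_noise M \<xi> \<zeta>"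
      and pos: "\<forall>j\<ge>1. \<omega> j > 0 \<and> \<gamma> j > 0" and one: "\<omega> 1 = 1" "\<gamma> 1 = 1"
      and ratio: "antimono_on {1..} (\<lambda>j. \<omega> j / \<gamma> j)" and r: "r > 0"
      and \<epsilon>: "\<epsilon> \<in> {0<..<1}" and \<sigma>: "\<sigma> \<in> {0<..<1}"
      and f: "f \<in> ellipsoid \<phi> \<gamma> r" and T: "T \<in> operator_class \<phi> \<psi> lam d"
    for \<phi> :: "nat \<Rightarrow> 'h" and \<psi> :: "nat \<Rightarrow> 'g" and M :: "'s measure" and \<xi> \<zeta> \<omega> \<gamma> r \<epsilon> \<sigma> f T
  proof -
    let ?rate = "\<lambda>k. max (\<omega> k / \<gamma> k) (delta \<omega> (\<lambda>j. sqrt (lam j)) k * \<epsilon>)"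
    let ?Km = "K_idx \<omega> \<epsilon> \<sigma> (\<lambda>j. sqrt (lam j / (4 * d)))"
    let ?m = "Suc (M_idx \<sigma> (\<lambda>j. sqrt (4 * d * lam j)))"
    let ?n = "nat \<lfloor>1 / \<sigma>\<rfloor>" and ?\<upsilon> = "upsilon \<omega> \<gamma> lam \<sigma>"
    let ?a = "sing_val \<phi> \<psi> T" and ?F = "coeff_of \<phi> f"
    let ?q = "exp (- (lam ?m / (72 * \<sigma> * d)))"
    have \<epsilon>\<sigma>: "0 < \<epsilon>" "0 < \<sigma>" "\<sigma> < 1" using \<epsilon> \<sigma> by auto
    have prob: "prob_space M" by (rule noise_prob_space[OF noise])
    have a: "lam j / d \<le> (?a j)\<^sup>2" "(?a j)\<^sup>2 \<le> d * lam j" if "1 \<le> j" for j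
    proof -
      have "1 / d \<le> (?a j)\<^sup>2 / lam j" "(?a j)\<^sup>2 / lam j \<le> d" "0 < lam j"
        using T lam_pos that unfolding operator_class_def by auto
      then show "lam j / d \<le> (?a j)\<^sup>2" "(?a j)\<^sup>2 \<le> d * lam j"
        using d_ge by (simp_all add: field_simps)
    qed
    have problem: "observed_inverse_problem \<phi> f \<omega> \<gamma> lam ?a d \<epsilon> \<sigma> r"
      using \<phi> pos one lam_pos d_ge a sing_val_pos[OF \<psi> T] \<epsilon> \<sigma> r f
      by unfold_locales (auto simp: orthonormal_basis_def
          intro: monotone_onD[OF ratio] monotone_onD[OF lam_dec])
    have "1 \<le> ?Km" by (rule K_idx_ge_1[where w = \<omega>, OF \<epsilon> \<sigma> one(1)])
    then have "Min (?rate ` {1..?Km}) \<in> ?rate ` {1..?Km}" by (intro Min_in) auto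
    then obtain k where k: "k \<in> {1..?Km}" and min_eq: "Min (?rate ` {1..?Km}) = ?rate k" by auto
    define W where "W x = ?q * (\<Sum>j=1..?m. exp ((\<zeta> j x)\<^sup>2 / 4))" for x
    define env where "env x =
        C\<^sub>1 * (delta \<omega> (\<lambda>j. sqrt (lam j)) k * \<epsilon>)
      + 16 * \<epsilon> * (\<Sum>l=1..?n. exp ((\<Sum>j=1..l. (\<xi> j x)\<^sup>2) / 4 - real l))
      + 64 * d * ?\<upsilon> * (\<Sum>j=1..?n. \<gamma> j * (?F j)\<^sup>2 * exp ((\<zeta> j x)\<^sup>2 / 4))
      + 3 * r * (\<omega> k / \<gamma> k)
      + ((\<Sum>j=1..?n. 1 / \<sigma> * (1 / \<sigma> ^ 3 * W x + 32 * \<sigma> ^ 3 * exp ((\<xi> j x)\<^sup>2 / 4)))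
        + (\<Sum>j=1..?n. \<gamma> j * (?F j)\<^sup>2 * (1 / \<sigma> ^ 3 * W x + 32 * \<sigma> ^ 3 * exp ((\<zeta> j x)\<^sup>2 / 4)))
        + r * W x)" for x
    have "wnorm_sq \<phi> \<omega> (adaptive_est \<phi> \<omega> \<epsilon> \<sigma> (obs_Y \<phi> \<psi> \<epsilon> \<xi> f T x) (obs_X \<phi> \<psi> \<sigma> \<zeta> T x) - f)
        \<le> ennreal (env x)" for x
    proof -
      interpret observed_inverse_problem \<phi> f \<omega> \<gamma> lam ?a "\<lambda>j. \<xi> j x" "\<lambda>j. \<zeta> j x" d \<epsilon> \<sigma> r
        by (rule problem)
      have obs: "obs_X \<phi> \<psi> \<sigma> \<zeta> T x = X" "obs_Y \<phi> \<psi> \<epsilon> \<xi> f T x = Y"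
        by (auto simp: obs_X_def obs_Y_def)
      show ?thesis
        unfolding obs env_def W_def C\<^sub>1_def
        by (rule adaptive_loss_envelope[OF k, unfolded exp_energy_def failure_def])
    qed
    then have "risk \<phi> \<psi> M \<xi> \<zeta> \<omega> \<epsilon> \<sigma> f T \<le> (\<integral>\<^sup>+x. ennreal (env x) \<partial>M)"
      unfolding risk_def by (rule nn_integral_mono)
    also have "\<dots> \<le> ennreal (C * (1 + r) * (?rate k + ?\<upsilon> + \<epsilon> + \<sigma>))"
    proof -
      define W\<^sub>0 where "W\<^sub>0 = ?q * (\<Sum>j=1..?m. 3 / 2)"
      define E where "E = (\<Sum>j=1..?n. \<gamma> j * (?F j)\<^sup>2)"
      interpret observed_inverse_problem \<phi> f \<omega> \<gamma> lam ?a "\<lambda>_. 0" "\<lambda>_. 0" d \<epsilon> \<sigma> r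
        by (rule problem)
      have E: "0 \<le> E" "E \<le> r"
        unfolding E_def using ellipsoid_sum[of ?n] energy_nonneg by (auto intro: sum_nonneg)
      have \<upsilon>: "0 \<le> ?\<upsilon>" by (rule upsilon_nonneg)
      have k1: "1 \<le> k" using k by simp
      have \<delta>: "0 \<le> delta \<omega> (\<lambda>j. sqrt (lam j)) k"
        using pos k1 by (intro delta_nonneg) (auto intro: less_imp_le)
      have ratio_nonneg: "0 \<le> \<omega> k / \<gamma> k" using pos k1 by (simp add: less_imp_le)
      note moment = mean_le_exp_noise[OF noise] and add = mean_le_add and cmult = mean_le_cmult
        and sum = mean_le_sum[OF prob finite_atLeastAtMost] and const = mean_le_const[OF prob]
      have W: "mean_le M W W\<^sub>0"
        unfolding W_def W\<^sub>0_def by (intro cmult sum moment) auto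
      have "mean_le M env
          (C\<^sub>1 * (delta \<omega> (\<lambda>j. sqrt (lam j)) k * \<epsilon>)
        + 16 * \<epsilon> * (\<Sum>l=1..?n. (3 / 4) ^ l)
        + 64 * d * ?\<upsilon> * (\<Sum>j=1..?n. \<gamma> j * (?F j)\<^sup>2 * (3 / 2))
        + 3 * r * (\<omega> k / \<gamma> k)
        + ((\<Sum>j=1..?n. 1 / \<sigma> * (1 / \<sigma> ^ 3 * W\<^sub>0 + 32 * \<sigma> ^ 3 * (3 / 2)))
          + (\<Sum>j=1..?n. \<gamma> j * (?F j)\<^sup>2 * (1 / \<sigma> ^ 3 * W\<^sub>0 + 32 * \<sigma> ^ 3 * (3 / 2)))
          + r * W\<^sub>0))"
        (is "mean_le M env ?c")
        unfolding env_def
        by (intro add const cmult sum moment mean_le_exp_noise_energy[OF noise] W)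
          (use \<delta> C\<^sub>1 \<epsilon>\<sigma> \<upsilon> d_ge r ratio_nonneg energy_nonneg in auto)
      then have "(\<integral>\<^sup>+x. ennreal (env x) \<partial>M) \<le> ennreal ?c"
        by (simp add: mean_le_def)
      also have "?c \<le> C * (1 + r) * (?rate k + ?\<upsilon> + \<epsilon> + \<sigma>)"
      proof -
        have W\<^sub>0: "0 \<le> W\<^sub>0" "W\<^sub>0 \<le> 3 * L * \<sigma> ^ 6"
        proof -
          show "0 \<le> W\<^sub>0" unfolding W\<^sub>0_def by simp
          have "lam ?m \<le> lam 1" by (rule lam_antimono) auto
          then show "W\<^sub>0 \<le> 3 * L * \<sigma> ^ 6"
            unfolding W\<^sub>0_def using lam_pos lam_one
            by (intro failure_mean_le[OF \<sigma>] tail_L[OF \<sigma>]) auto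
        qed
        define S where "S = 1 / \<sigma> ^ 3 * W\<^sub>0 + 48 * \<sigma> ^ 3"
        have S: "0 \<le> S" "S \<le> (3 * L + 48) * \<sigma> ^ 3"
        proof -
          show "0 \<le> S" unfolding S_def using W\<^sub>0 \<epsilon>\<sigma> by simp
          have "1 / \<sigma> ^ 3 * W\<^sub>0 \<le> 1 / \<sigma> ^ 3 * (3 * L * \<sigma> ^ 6)"
            using W\<^sub>0 \<epsilon>\<sigma> by (intro mult_left_mono) auto
          also have "\<dots> = 3 * L * \<sigma> ^ 3" using \<epsilon>\<sigma> by (simp add: eval_nat_numeral)
          finally show "S \<le> (3 * L + 48) * \<sigma> ^ 3" unfolding S_def by (simp add: algebra_simps)
        qed
        have \<sigma>_pow: "\<sigma> ^ 3 \<le> \<sigma>" "\<sigma> ^ 6 \<le> \<sigma>"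
          using \<epsilon>\<sigma> power_decreasing[of 1 3 \<sigma>] power_decreasing[of 1 6 \<sigma>] by auto
        have t1: "C\<^sub>1 * (delta \<omega> (\<lambda>j. sqrt (lam j)) k * \<epsilon>) \<le> C * ?rate k"
          using C C\<^sub>1 \<delta> \<epsilon>\<sigma> by (intro mult_mono) auto
        have t2: "16 * \<epsilon> * (\<Sum>l=1..?n. (3 / 4) ^ l) \<le> C * \<epsilon>"
        proof -
          have "16 * \<epsilon> * (\<Sum>l=1..?n. (3 / 4) ^ l) \<le> 16 * \<epsilon> * 3"
            using \<epsilon>\<sigma> by (intro mult_left_mono sum_three_quarters_power_le) auto
          also have "\<dots> = 48 * \<epsilon>" by simp
          also have "\<dots> \<le> C * \<epsilon>" using C \<epsilon>\<sigma> by (intro mult_right_mono) auto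
          finally show ?thesis .
        qed
        have t3: "64 * d * ?\<upsilon> * (\<Sum>j=1..?n. \<gamma> j * (?F j)\<^sup>2 * (3 / 2)) \<le> C * (r * ?\<upsilon>)"
        proof -
          have "64 * d * ?\<upsilon> * (\<Sum>j=1..?n. \<gamma> j * (?F j)\<^sup>2 * (3 / 2)) = 96 * d * (E * ?\<upsilon>)"
            unfolding E_def by (simp only: sum_distrib_right[symmetric]) simp
          also have "\<dots> \<le> C * (r * ?\<upsilon>)"
            using C E \<upsilon> d_ge by (intro mult_mono) auto
          finally show ?thesis .
        qed
        have t4: "3 * r * (\<omega> k / \<gamma> k) \<le> C * (r * ?rate k)"
          unfolding mult.assoc using C r ratio_nonneg by (intro mult_mono mult_nonneg_nonneg) auto
        have t5: "(\<Sum>j=1..?n. 1 / \<sigma> * (1 / \<sigma> ^ 3 * W\<^sub>0 + 32 * \<sigma> ^ 3 * (3 / 2))) \<le> C * \<sigma>"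
        proof -
          have "(\<Sum>j=1..?n. 1 / \<sigma> * (1 / \<sigma> ^ 3 * W\<^sub>0 + 32 * \<sigma> ^ 3 * (3 / 2))) = real ?n * (1 / \<sigma> * S)"
            by (simp add: S_def)
          also have "\<dots> \<le> 1 / \<sigma> * (1 / \<sigma> * ((3 * L + 48) * \<sigma> ^ 3))"
            using n_le S \<epsilon>\<sigma> by (intro mult_mono mult_left_mono) auto
          also have "\<dots> = (3 * L + 48) * \<sigma>" using \<epsilon>\<sigma> by (simp add: eval_nat_numeral)
          also have "\<dots> \<le> C * \<sigma>" using C \<epsilon>\<sigma> by (intro mult_right_mono) auto
          finally show ?thesis .
        qed
        have t6: "(\<Sum>j=1..?n. \<gamma> j * (?F j)\<^sup>2 * (1 / \<sigma> ^ 3 * W\<^sub>0 + 32 * \<sigma> ^ 3 * (3 / 2))) + r * W\<^sub>0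
            \<le> C * (r * \<sigma>)"
        proof -
          have "(\<Sum>j=1..?n. \<gamma> j * (?F j)\<^sup>2 * (1 / \<sigma> ^ 3 * W\<^sub>0 + 32 * \<sigma> ^ 3 * (3 / 2))) = E * S"
            unfolding E_def S_def by (simp add: sum_distrib_right)
          moreover have "E * S \<le> r * ((3 * L + 48) * \<sigma>)"
          proof (intro mult_mono)
            have "(3 * L + 48) * \<sigma> ^ 3 \<le> (3 * L + 48) * \<sigma>"
              using \<sigma>_pow L by (intro mult_left_mono) auto
            then show "S \<le> (3 * L + 48) * \<sigma>" using S by linarith
          qed (use E S r in auto)
          moreover have "r * W\<^sub>0 \<le> r * (3 * L * \<sigma>)"
          proof (intro mult_left_mono)
            have "3 * L * \<sigma> ^ 6 \<le> 3 * L * \<sigma>"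
              using \<sigma>_pow L by (intro mult_left_mono) auto
            then show "W\<^sub>0 \<le> 3 * L * \<sigma>" using W\<^sub>0 by linarith
          qed (use r in auto)
          moreover have "r * ((3 * L + 48) * \<sigma>) + r * (3 * L * \<sigma>) = (48 + 6 * L) * (r * \<sigma>)"
            by (simp add: algebra_simps)
          moreover have "(48 + 6 * L) * (r * \<sigma>) \<le> C * (r * \<sigma>)"
            using C r \<epsilon>\<sigma> by (intro mult_right_mono) auto
          ultimately show ?thesis by linarith
        qed
        have "0 \<le> C * ?\<upsilon>" "0 \<le> C * (r * \<epsilon>)"
          using C \<upsilon> r \<epsilon>\<sigma> by simp_all
        moreover have "C * (1 + r) * (?rate k + ?\<upsilon> + \<epsilon> + \<sigma>)
            = C * ?rate k + C * (r * ?rate k) + C * ?\<upsilon> + C * (r * ?\<upsilon>)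
              + C * \<epsilon> + C * (r * \<epsilon>) + C * \<sigma> + C * (r * \<sigma>)"
          by (simp only: distrib_left distrib_right mult_1_right mult_1 mult_ac add_ac)
        ultimately show ?thesis using t1 t2 t3 t4 t5 t6 by linarith
      qed
      finally show ?thesis using ennreal_leI order_trans by blast
    qed
    finally show ?thesis unfolding min_eq .
  qed
  show ?thesis
    using C(1) by (intro exI[of _ C] conjI allI impI ballI SUP_least bound) auto
qed

end
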